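(* Let $q$ be a power of $2$, let $m$ be a positive integer, and let $a\in\mathbb{F}_q^*$. Let $f$ be a degenerate quadratic form over $\mathbb{F}_{q^m}$ with $\mathrm{rank}\, f=2s+1$ ($2s+1<m$), which is equivalent to Type III. Let $D_f=\{x\in\mathbb{F}_{q^m}: f(x)=a\}$ and let $\mathcal{C}_{D_f}=\{(\mathrm{Tr}(xd))_{d\in D_f}: x\in\mathbb{F}_{q^m}\}$, a linear code over $\mathbb{F}_q$ of length $|D_f|$. Then $\mathcal{C}_{D_f}$ has the following weight hierarchy: $$d_r(\mathcal{C}_{D_f})=\begin{cases} q^{m-1}-q^{m-r-1}-q^{m-s-2}, & \text{if } 1\le r\le s,\\ q^{m-1}-q^{m-r-1}-q^{m-r-2}, & \text{if } s+1\le r<m-1,\\ q^{m-1}-1, & \text{if } r=m-1,\\ q^{m-1}, & \text{if } r=m.\end{cases}$$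
   Context: $\mathrm{Tr}$ is the trace from $\mathbb{F}_{q^m}$ to $\mathbb{F}_q$. Generalized Hamming weights: for a $k$-dimensional linear code $\mathcal{C}\subseteq\mathbb{F}_q^n$ and an $\mathbb{F}_q$-subspace $H$ of $\mathcal{C}$, $\mathrm{supp}(H)=\{i: c_i\ne 0 \text{ for some } (c_1,\dots,c_n)\in H\}$. For $1\le r\le k$, $d_r(\mathcal{C})=\min\{|\mathrm{supp}(H)| : H \text{ an } r\text{-dimensional subspace of } \mathcal{C}\}$; the set $\{d_1(\mathcal C),\dots,d_k(\mathcal C)\}$ is the weight hierarchy of $\mathcal{C}$. Quadratic forms: fix a basis $\varepsilon_1,\dots,\varepsilon_m$ of $\mathbb{F}_{q^m}$ over $\mathbb{F}_q$ and identify $x=\sum x_i\varepsilon_i$ with $(x_1,\dots,x_m)\in\mathbb{F}_q^m$. A quadratic form over $\mathbb{F}_{q^m}$ is a map $f:\mathbb{F}_{q^m}\to\mathbb{F}_q$ of the form $f(x)=\sum_{1\le i\le j\le m}a_{ij}x_ix_j$ with $a_{ij}\in\mathbb{F}_q$. Put $\ker f=\{x\in\mathbb{F}_{q^m}: f(x+y)=f(y)\text{ for all }y\in\mathbb{F}_{q^m}\}$ (an $\mathbb{F}_q$-subspace). $f$ is non-degenerate if $\ker f=\{0\}$, and degenerate otherwise; $\mathrm{rank}\, f=m-\dim_{\mathbb{F}_q}\ker f$. Types: a quadratic form of rank $t$ is equivalent, under an invertible $\mathbb{F}_q$-linear change of coordinates, to exactly one of: Type I ($t$ even): $x_1x_2+x_3x_4+\cdots+x_{t-1}x_t$;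 Type II ($t$ even): $x_1x_2+\cdots+x_{t-3}x_{t-2}+\alpha x_{t-1}^2+x_{t-1}x_t+\alpha x_t^2$ with $\alpha\in\mathbb{F}_q\setminus\{x^2+x: x\in\mathbb{F}_q\}$; Type III ($t$ odd): $x_1x_2+\cdots+x_{t-2}x_{t-1}+x_t^2$.
   Formalization: The formal theorem assumes s ≥ 1. For s = 0 and m ≥ 3, D_f is an affine hyperplane and d_r = q^{m-1} - q^{m-r-1} for r < m-1, so the stated formula fails; the corner s = 0, m = 2, where it holds, is also left out. *)

theory Defs
  imports Complex_Main "HOL-Library.Cardinality" "HOL-Library.Function_Algebras"
begin

text \<open>
  A field extension $L/K$ is given by two types and a unital ring homomorphism \<open>emb\<close> from
  \<open>K\<close> to \<open>L\<close>.  For finite types, \<open>K\<close> is the field with \<open>CARD('k)\<close> elements and \<open>L\<close> the field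
  with \<open>CARD('l)\<close> elements.
\<close>

locale field_embedding =
  fixes emb :: "'k::field \<Rightarrow> 'l::field"
  assumes emb_add: "emb (x + y) = emb x + emb y"
    and emb_mult: "emb (x * y) = emb x * emb y"
    and emb_one: "emb 1 = 1"

definition ext_scale :: "('k::field \<Rightarrow> 'l::field) \<Rightarrow> 'k \<Rightarrow> 'l \<Rightarrow> 'l" where
  "ext_scale emb c x = emb c * x"

lemma (in field_embedding) vector_space_ext_scale: "vector_space (ext_scale emb)"
  by unfold_locales
    (simp_all add: ext_scale_def emb_add emb_mult emb_one algebra_simps)

text \<open>
  The trace of the extension of finite fields of degree \<open>m\<close>.  The sum of conjugates lies in
  the image of \<open>emb\<close>; \<open>inv emb\<close> moves it to the ground field.
\<close>

definition trace :: "('k::{field,finite} \<Rightarrow> 'l::{field,finite}) \<Rightarrow> nat \<Rightarrow> 'l \<Rightarrow> 'k" where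
  "trace emb m x = inv emb (\<Sum>i<m. x ^ (CARD('k) ^ i))"

definition is_basis :: "('k::field \<Rightarrow> 'l::field) \<Rightarrow> nat \<Rightarrow> (nat \<Rightarrow> 'l) \<Rightarrow> bool" where
  "is_basis emb m \<epsilon> \<longleftrightarrow>
     inj_on \<epsilon> {1..m} \<and>
     \<not> module.dependent (ext_scale emb) (\<epsilon> ` {1..m}) \<and>
     module.span (ext_scale emb) (\<epsilon> ` {1..m}) = UNIV"

definition coord :: "('k::field \<Rightarrow> 'l::field) \<Rightarrow> nat \<Rightarrow> (nat \<Rightarrow> 'l) \<Rightarrow> 'l \<Rightarrow> nat \<Rightarrow> 'k" where
  "coord emb m \<epsilon> x i = module.representation (ext_scale emb) (\<epsilon> ` {1..m}) x (\<epsilon> i)"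

definition quadratic_form ::
  "('k::field \<Rightarrow> 'l::field) \<Rightarrow> nat \<Rightarrow> (nat \<Rightarrow> 'l) \<Rightarrow> ('l \<Rightarrow> 'k) \<Rightarrow> bool" where
  "quadratic_form emb m \<epsilon> f \<longleftrightarrow>
     (\<exists>a :: nat \<Rightarrow> nat \<Rightarrow> 'k. \<forall>x.
        f x = (\<Sum>i=1..m. \<Sum>j=i..m. a i j * coord emb m \<epsilon> x i * coord emb m \<epsilon> x j))"

definition qf_ker :: "('l::field \<Rightarrow> 'k::field) \<Rightarrow> 'l set" where
  "qf_ker f = {x. \<forall>y. f (x + y) = f y}"

definition nondegenerate :: "('l::field \<Rightarrow> 'k::field) \<Rightarrow> bool" where
  "nondegenerate f \<longleftrightarrow> qf_ker f = {0}"

definition qf_rank :: "('k::field \<Rightarrow> 'l::field) \<Rightarrow> nat \<Rightarrow> ('l \<Rightarrow> 'k) \<Rightarrow> nat" where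
  "qf_rank emb m f = m - vector_space.dim (ext_scale emb) (qf_ker f)"

definition qf_equivalent ::
  "('k::field \<Rightarrow> 'l::field) \<Rightarrow> ('l \<Rightarrow> 'k) \<Rightarrow> ('l \<Rightarrow> 'k) \<Rightarrow> bool" where
  "qf_equivalent emb f g \<longleftrightarrow>
     (\<exists>T. Vector_Spaces.linear (ext_scale emb) (ext_scale emb) T \<and> bij T \<and> (\<forall>x. f x = g (T x)))"

text \<open>
  For odd \<open>t\<close>: the form $x_1 x_2 + x_3 x_4 + \cdots + x_{t-2} x_{t-1} + x_t^2$.
\<close>

definition type_III ::
  "('k::field \<Rightarrow> 'l::field) \<Rightarrow> nat \<Rightarrow> (nat \<Rightarrow> 'l) \<Rightarrow> nat \<Rightarrow> 'l \<Rightarrow> 'k" where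
  "type_III emb m \<epsilon> t x =
     (\<Sum>i=1..(t - 1) div 2. coord emb m \<epsilon> x (2 * i - 1) * coord emb m \<epsilon> x (2 * i))
     + (coord emb m \<epsilon> x t)\<^sup>2"

text \<open>
  Words of length $|D|$ are indexed by the elements of \<open>D\<close> itself instead of by an enumeration
  of \<open>D\<close>.  They are represented as total functions that vanish outside \<open>D\<close>, so indices
  outside \<open>D\<close> never contribute to a support.
\<close>

definition word_scale :: "'k::field \<Rightarrow> ('i \<Rightarrow> 'k) \<Rightarrow> 'i \<Rightarrow> 'k" where
  "word_scale c w = (\<lambda>i. c * w i)"

lemma vector_space_word_scale: "vector_space word_scale"
  by unfold_locales (auto simp: word_scale_def fun_eq_iff algebra_simps)

definition trace_code ::
  "('k::{field,finite} \<Rightarrow> 'l::{field,finite}) \<Rightarrow> nat \<Rightarrow> 'l set \<Rightarrow> ('l \<Rightarrow> 'k) set" where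
  "trace_code emb m D = {(\<lambda>d. if d \<in> D then trace emb m (x * d) else 0) | x. True}"

definition code_supp :: "('i \<Rightarrow> 'k::field) set \<Rightarrow> 'i set" where
  "code_supp H = {i. \<exists>c\<in>H. c i \<noteq> 0}"

definition gen_hamming_weight :: "('i::finite \<Rightarrow> 'k::{field,finite}) set \<Rightarrow> nat \<Rightarrow> nat" where
  "gen_hamming_weight C r =
     Min {card (code_supp H) | H.
       H \<subseteq> C \<and> module.subspace word_scale H \<and> vector_space.dim word_scale H = r}"

end

theory Submission
  imports Defs "HOL-Library.FuncSet" "HOL-Computational_Algebra.Polynomial"
begin

text \<open>
  A codeword of the trace code vanishes at \<open>d\<close> iff \<open>d\<close> lies in a hyperplane, so the \<open>r\<close>-th weight is
  \<open>|D|\<close> minus the maximum of $N(W) = |\{x \in W : f(x) = a\}|$ over subspaces \<open>W\<close> of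
  codimension \<open>r\<close>.

  Upper bound: since squaring is bijective, all non-zero values of \<open>f\<close> are attained equally often on
  \<open>W\<close>, so the second moment of the value distribution determines \<open>N(W)\<close> up to a sign: with \<open>R\<close> the
  radical of the polar form \<open>B\<close> on \<open>W\<close>, either $q N(W) = |W|$, or \<open>f\<close> vanishes on \<open>R\<close> and
  $(q N(W) - |W|)^2 = |W| |R|$. In the second case \<open>R\<close> is small, because \<open>R\<close> is properly
  contained in the orthogonal space of \<open>W\<close> (the radical of the whole space contains a vector with
  \<open>f \<noteq> 0\<close>), and, when $N(W) \neq 0$, it has codimension at least 2 in \<open>W\<close>.

  Lower bound: if \<open>T \<subseteq> W\<close> is totally singular, of codimension 2 in its orthogonal space
  in \<open>W\<close>, with no singular vector of the latter outside \<open>T\<close>, then $q N(W) = |W| + q |T|$;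
  coordinate subspaces of this kind attain the upper bounds.
\<close>

section \<open>Counting in finite vector spaces\<close>

lemma sum_if_card:
  assumes "finite S"
  shows "(\<Sum>x\<in>S. if P x then a else b) = int (card {x\<in>S. P x}) * a + (int (card S) - int (card {x\<in>S. P x})) * b"
proof -
  have "card S = card {x\<in>S. P x} + card {x\<in>S. \<not> P x}"
    using assms by (subst card_Un_disjoint[symmetric]) (auto intro: arg_cong[where f = card])
  then have c: "int (card {x\<in>S. \<not> P x}) = int (card S) - int (card {x\<in>S. P x})" by simp
  have "(\<Sum>x\<in>S. if P x then a else b) = int (card {x\<in>S. P x}) * a + int (card {x\<in>S. \<not> P x}) * b"
    using assms by (simp add: sum.If_cases Int_def)
  then show ?thesis unfolding c .
qed

lemma card_pairs_eq_sum:
  assumes "finite A" "finite B"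
  shows "card {(x, y). x \<in> A \<and> y \<in> B \<and> P x y} = (\<Sum>x\<in>A. card {y\<in>B. P x y})"
proof -
  have "{(x, y). x \<in> A \<and> y \<in> B \<and> P x y} = Sigma A (\<lambda>x. {y\<in>B. P x y})" by auto
  then show ?thesis using assms by simp
qed

lemma CARD_field_gt_1: "CARD('k::{field,finite}) > 1"
proof -
  have "card {0, 1 :: 'k} \<le> CARD('k)" by (intro card_mono) auto
  then show ?thesis by simp
qed

locale finite_vector_space = vector_space scale
  for scale :: "'k::{field,finite} \<Rightarrow> 'v::{ab_group_add,finite} \<Rightarrow> 'v" (infixr \<open>*s\<close> 75)
begin

text \<open>Fibres are translates of one another, so they share the size of \<open>W\<close>
  equally. Only additivity is assumed, not linearity, so that the lemma also covers a quadratic form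
  on its radical, where it is additive but scales by squares.\<close>

lemma card_fibre_additive:
  assumes W: "subspace W"
    and add: "\<And>x y. x \<in> W \<Longrightarrow> y \<in> W \<Longrightarrow> \<phi> (x + y) = \<phi> x + \<phi> y"
    and surj: "\<And>c :: 'k. \<exists>w\<in>W. \<phi> w = c"
  shows "CARD('k) * card {w\<in>W. \<phi> w = c} = card W"
proof -
  have fib: "card {w\<in>W. \<phi> w = d} = card {w\<in>W. \<phi> w = c}" for d
  proof -
    obtain u where u: "u \<in> W" "\<phi> u = c - d" using surj by blast
    have nu: "\<phi> (x - u) = \<phi> x - \<phi> u" if "x \<in> W" for x
      using add[of "x - u" u] u(1) that W by (simp add: subspace_diff)
    have "bij_betw (\<lambda>w. w + u) {w\<in>W. \<phi> w = d} {w\<in>W. \<phi> w = c}"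
      by (rule bij_betw_byWitness[where f' = "\<lambda>w. w - u"])
        (use u nu add W in \<open>auto simp: subspace_add subspace_diff\<close>)
    then show ?thesis by (rule bij_betw_same_card)
  qed
  have "W = (\<Union>d. {w\<in>W. \<phi> w = d})" by auto
  then have "card W = card (\<Union>d. {w\<in>W. \<phi> w = d})" by (rule arg_cong)
  also have "\<dots> = (\<Sum>d\<in>UNIV. card {w\<in>W. \<phi> w = d})"
    by (rule card_UN_disjoint) auto
  also have "\<dots> = (\<Sum>d\<in>(UNIV :: 'k set). card {w\<in>W. \<phi> w = c})" by (rule sum.cong[OF refl fib])
  also have "\<dots> = CARD('k) * card {w\<in>W. \<phi> w = c}" by simp
  finally show ?thesis by simp
qed

lemma card_fibre_linear:
  assumes W: "subspace W"
    and add: "\<And>x y. x \<in> W \<Longrightarrow> y \<in> W \<Longrightarrow> \<phi> (x + y) = \<phi> x + \<phi> y"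
    and scale: "\<And>c x. x \<in> W \<Longrightarrow> \<phi> (c *s x) = c * \<phi> x"
    and "w \<in> W" "\<phi> w \<noteq> (0 :: 'k)"
  shows "CARD('k) * card {w\<in>W. \<phi> w = c} = card W"
proof (rule card_fibre_additive[OF W add])
  fix c
  have "\<phi> ((c / \<phi> w) *s w) = c" using assms by simp
  then show "\<exists>w\<in>W. \<phi> w = c" using W \<open>w \<in> W\<close> subspace_scale by blast
qed

text \<open>The sum of \<open>R\<close> and the line through \<open>w\<close> is direct and lies in
  \<open>X\<close>. This replaces comparisons of dimensions by a factor
  \<open>CARD('k)\<close>.\<close>

lemma card_subspace_less:
  assumes R: "subspace R" and X: "subspace X" and "R \<subseteq> X" and w: "w \<in> X" "w \<notin> R"
  shows "CARD('k) * card R \<le> card X"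
proof -
  have "inj_on (\<lambda>(c, x). c *s w + x) (UNIV \<times> R)"
  proof (rule inj_onI, clarify)
    fix c x d y assume xy: "x \<in> R" "y \<in> R" and eq: "c *s w + x = d *s w + y"
    have e: "(c - d) *s w = y - x" using eq by (simp add: algebra_simps)
    have "c = d"
    proof (rule ccontr)
      assume "c \<noteq> d"
      have "(1 / (c - d)) *s ((c - d) *s w) \<in> R" unfolding e
        using R xy by (simp add: subspace_diff subspace_scale)
      then show False using w(2) \<open>c \<noteq> d\<close> by simp
    qed
    then show "c = d \<and> x = y" using eq by simp
  qed
  moreover have "(\<lambda>(c, x). c *s w + x) ` (UNIV \<times> R) \<subseteq> X"
    using assms by (auto intro!: subspace_add subspace_scale)
  ultimately have "card ((UNIV :: 'k set) \<times> R) \<le> card X"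
    by (metis card_image card_mono finite)
  then show ?thesis by simp
qed

lemma card_span_independent:
  assumes "independent B"
  shows "card (span B) = CARD('k) ^ card B"
proof -
  have "finite B" by simp
  then show ?thesis using assms
  proof (induction B rule: finite_induct)
    case (insert b B)
    have ind: "independent B" and b: "b \<notin> span B"
      using insert.prems insert.hyps by (simp_all add: independent_insert)
    have "bij_betw (\<lambda>(c, x). c *s b + x) (UNIV \<times> span B) (span (insert b B))"
      unfolding bij_betw_def
    proof
      show "inj_on (\<lambda>(c, x). c *s b + x) (UNIV \<times> span B)"
      proof (rule inj_onI, clarify)
        fix c x d y assume xy: "x \<in> span B" "y \<in> span B" and eq: "c *s b + x = d *s b + y"
        have e: "(c - d) *s b = y - x" using eq by (simp add: algebra_simps)
        have "c = d"
        proof (rule ccontr)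
          assume "c \<noteq> d"
          have "(1 / (c - d)) *s ((c - d) *s b) \<in> span B" unfolding e
            using xy by (simp add: span_diff span_scale)
          then show False using b \<open>c \<noteq> d\<close> by simp
        qed
        then show "c = d \<and> x = y" using eq by simp
      qed
      show "(\<lambda>(c, x). c *s b + x) ` (UNIV \<times> span B) = span (insert b B)"
      proof (intro equalityI subsetI)
        fix x assume "x \<in> (\<lambda>(c, x). c *s b + x) ` (UNIV \<times> span B)"
        then obtain c y where "x = c *s b + y" "y \<in> span B" by auto
        then show "x \<in> span (insert b B)"
          by (auto simp: span_breakdown_eq intro!: exI[of _ c])
      next
        fix x assume "x \<in> span (insert b B)"
        then obtain c where "x - c *s b \<in> span B" by (auto simp: span_breakdown_eq)
        then show "x \<in> (\<lambda>(c, x). c *s b + x) ` (UNIV \<times> span B)"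
          by (intro image_eqI[where x = "(c, x - c *s b)"]) auto
      qed
    qed
    then have "card (span (insert b B)) = card ((UNIV :: 'k set) \<times> span B)"
      by (rule bij_betw_same_card[symmetric])
    then show ?case using insert.IH[OF ind] insert.hyps by simp
  qed simp
qed

lemma card_subspace:
  assumes "subspace X"
  shows "card X = CARD('k) ^ dim X"
proof -
  obtain B where "B \<subseteq> X" "independent B" "X \<subseteq> span B" "card B = dim X"
    using basis_exists by blast
  then show ?thesis
    using card_span_independent[of B] assms by (metis span_minimal subset_antisym)
qed

text \<open>Cardinalities stand in for dimensions in all later arguments; this is the bridge back to
  \<open>dim\<close> in the definition of the weights.\<close>

lemma dim_eq_iff_card:
  assumes "subspace X"
  shows "dim X = n \<longleftrightarrow> card X = CARD('k) ^ n"
  using card_subspace[OF assms] CARD_field_gt_1[where 'k = 'k] by simp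

text \<open>Double count of the pairs with \<open>\<beta> x w = 0\<close>: for a fixed entry the
  other one ranges over a hyperplane or over everything. The form may be degenerate, so the lemma
  serves both the polar form and the trace form.\<close>

lemma card_orthogonal:
  assumes W: "subspace W"
    and add1: "\<And>x y z. \<beta> (x + y) z = \<beta> x z + \<beta> y z" and scale1: "\<And>c x z. \<beta> (c *s x) z = c * \<beta> x z"
    and add2: "\<And>x y z. \<beta> z (x + y) = \<beta> z x + \<beta> z y" and scale2: "\<And>c x z. \<beta> z (c *s x) = c * \<beta> z x"
  shows "card {x. \<forall>w\<in>W. \<beta> x w = (0 :: 'k)} * card W = CARD('v) * card {w\<in>W. \<forall>x. \<beta> x w = 0}"
proof -
  let ?P = "card {x. \<forall>w\<in>W. \<beta> x w = 0}" and ?R = "card {w\<in>W. \<forall>x. \<beta> x w = 0}"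
  let ?N = "int (card {(x, w). x \<in> UNIV \<and> w \<in> W \<and> \<beta> x w = 0})"
  have "int CARD('k) * ?N = (\<Sum>x\<in>UNIV. int (CARD('k) * card {w\<in>W. \<beta> x w = 0}))"
    by (subst card_pairs_eq_sum) (simp_all add: sum_distrib_left)
  also have "\<dots> = (\<Sum>x\<in>UNIV. if \<forall>w\<in>W. \<beta> x w = 0 then int (CARD('k) * card W) else int (card W))"
  proof (rule sum.cong[OF refl])
    fix x
    show "int (CARD('k) * card {w\<in>W. \<beta> x w = 0}) = (if \<forall>w\<in>W. \<beta> x w = 0 then int (CARD('k) * card W) else int (card W))"
    proof (cases "\<forall>w\<in>W. \<beta> x w = 0")
      case True
      then have "{w\<in>W. \<beta> x w = 0} = W" by auto
      then show ?thesis using True by simp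
    next
      case False
      then obtain w where "w \<in> W" "\<beta> x w \<noteq> 0" by blast
      then have "CARD('k) * card {w\<in>W. \<beta> x w = 0} = card W"
        by (intro card_fibre_linear[of W "\<beta> x"] W) (auto simp: add2 scale2)
      then show ?thesis by (subst if_not_P[OF False]) simp
    qed
  qed
  also have "\<dots> = int ?P * (CARD('k) * card W) + (CARD('v) - int ?P) * card W"
    by (subst sum_if_card) simp_all
  finally have 1: "int CARD('k) * ?N = int ?P * (CARD('k) * card W) + (CARD('v) - int ?P) * card W" .
  have "?N = int (card {(w, x). w \<in> W \<and> x \<in> UNIV \<and> \<beta> x w = 0})"
    by (intro arg_cong[where f = int] bij_betw_same_card[of prod.swap])
      (auto simp: bij_betw_def inj_on_def image_def)
  then have "int CARD('k) * ?N = (\<Sum>w\<in>W. int (CARD('k) * card {x\<in>UNIV. \<beta> x w = 0}))"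
    by (simp only:) (subst card_pairs_eq_sum, simp_all add: sum_distrib_left)
  also have "\<dots> = (\<Sum>w\<in>W. if \<forall>x. \<beta> x w = 0 then int (CARD('k) * CARD('v)) else int (CARD('v)))"
  proof (rule sum.cong[OF refl])
    fix w
    show "int (CARD('k) * card {x\<in>UNIV. \<beta> x w = 0}) = (if \<forall>x. \<beta> x w = 0 then int (CARD('k) * CARD('v)) else int (CARD('v)))"
    proof (cases "\<forall>x. \<beta> x w = 0")
      case False
      then obtain x where "\<beta> x w \<noteq> 0" by blast
      then have "CARD('k) * card {x\<in>UNIV. \<beta> x w = 0} = CARD('v)"
        by (intro card_fibre_linear[of UNIV "\<lambda>x. \<beta> x w"]) (auto simp: add1 scale1)
      then show ?thesis by (subst if_not_P[OF False]) simp
    qed simp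
  qed
  also have "\<dots> = int ?R * (CARD('k) * CARD('v)) + (card W - int ?R) * CARD('v)"
    by (subst sum_if_card) simp_all
  finally have 2: "int CARD('k) * ?N = int ?R * (CARD('k) * CARD('v)) + (card W - int ?R) * CARD('v)" .
  \<comment> \<open>In the difference of the two counts the terms \<open>CARD('v) * card W\<close>
    cancel, which leaves a common factor \<open>CARD('k) - 1\<close>.\<close>
  have "(int CARD('k) - 1) * (int ?P * card W) = (int CARD('k) - 1) * (CARD('v) * int ?R)"
    using 1 2 by (simp add: algebra_simps)
  then have "int ?P * card W = CARD('v) * int ?R"
    using CARD_field_gt_1[where 'k = 'k] by (subst (asm) mult_left_cancel) linarith+
  then show ?thesis unfolding of_nat_mult[symmetric] of_nat_eq_iff .
qed

end

section \<open>Level sets of quadratic forms in characteristic two\<close>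

text \<open>Since \<open>x = - x\<close>, a square determines its root, and an injective self-map of
  a finite field is onto.\<close>

lemma char2_square_surj:
  assumes "(1 :: 'k::{field,finite}) + 1 = 0"
  shows "\<exists>d :: 'k. d\<^sup>2 = c"
proof -
  have "inj (\<lambda>x :: 'k. x\<^sup>2)"
  proof (rule injI)
    fix x y :: 'k assume "x\<^sup>2 = y\<^sup>2"
    then have "x = y \<or> x = - y" by (simp add: power2_eq_iff)
    moreover have "y + y = (1 + 1) * y" by (simp only: distrib_right mult_1_left)
    then have "- y = y" using assms by (simp add: minus_unique)
    ultimately show "x = y" by auto
  qed
  then have "surj (\<lambda>x :: 'k. x\<^sup>2)" by (rule finite_UNIV_inj_surj[OF finite])
  then show ?thesis by (metis surjD)
qed

text \<open>\<open>B\<close> is the polar form of \<open>f\<close>. In characteristic two it is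
  alternating and does not determine \<open>f\<close>.\<close>

locale quadratic_space = finite_vector_space scale
  for scale :: "'k::{field,finite} \<Rightarrow> 'v::{ab_group_add,finite} \<Rightarrow> 'v" (infixr \<open>*s\<close> 75) +
  fixes f :: "'v \<Rightarrow> 'k" and B :: "'v \<Rightarrow> 'v \<Rightarrow> 'k"
  assumes char2: "(1 :: 'k) + 1 = 0"
    and f_scale: "f (c *s x) = c\<^sup>2 * f x"
    and f_add: "f (x + y) = f x + f y + B x y"
    and B_add_left: "B (x + y) z = B x z + B y z"
    and B_scale_left: "B (c *s x) z = c * B x z"
begin

lemma add_self: "c + c = (0 :: 'k)"
proof -
  have "c + c = (1 + 1) * c" by (simp only: distrib_right mult_1_left)
  then show ?thesis using char2 by simp
qed

lemma uminus_id: "- c = (c :: 'k)"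
  using add_self[of c] by (simp add: minus_unique)

lemma f_zero: "f 0 = 0"
  using f_scale[of 0 0] by simp

lemma B_sym: "B x y = B y x"
  using f_add[of x y] f_add[of y x] by (simp add: add.commute)

lemma B_add_right: "B z (x + y) = B z x + B z y"
  using B_add_left B_sym by simp

lemma B_scale_right: "B z (c *s x) = c * B z x"
  using B_scale_left B_sym by simp

lemma B_zero: "B x 0 = 0" "B 0 x = 0"
  using B_scale_right[of x 0 0] B_scale_left[of 0 0 x] by simp_all

lemma B_self: "B x x = 0"
proof -
  have "x + x = (1 + 1) *s x" by (simp only: scale_left_distrib scale_one)
  then have "x + x = 0" using char2 by simp
  then show ?thesis using f_add[of x x] by (simp add: f_zero add_self)
qed

lemma subspace_perp: "subspace W \<Longrightarrow> subspace {x\<in>W. \<forall>w\<in>U. B w x = 0}"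
  by (auto simp: subspace_def B_add_right B_scale_right B_zero)

text \<open>Scaling by a square root of \<open>a / b\<close> carries one level set onto the
  other.\<close>

lemma card_value_eq:
  assumes W: "subspace W" and "a \<noteq> 0" "b \<noteq> 0"
  shows "card {x\<in>W. f x = b} = card {x\<in>W. f x = a}"
proof -
  obtain c where c: "c\<^sup>2 = a / b" using char2_square_surj[OF char2] by blast
  then have "c \<noteq> 0" using assms by auto
  have "bij_betw (\<lambda>x. c *s x) {x\<in>W. f x = b} {x\<in>W. f x = a}"
    by (rule bij_betw_byWitness[where f' = "\<lambda>x. (1 / c) *s x"])
      (use \<open>c \<noteq> 0\<close> c assms in \<open>auto simp: f_scale power_divide subspace_scale\<close>)
  then show ?thesis by (rule bij_betw_same_card)
qed

text \<open>The function \<open>g\<close> is left open so that \<open>int\<close> yields the first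
  moment of the value distribution and the square yields the second.\<close>

lemma sum_card_values:
  assumes W: "subspace W" and "a \<noteq> 0"
  shows "(\<Sum>b\<in>UNIV. g (card {x\<in>W. f x = b}))
    = g (card {x\<in>W. f x = 0}) + (int CARD('k) - 1) * g (card {x\<in>W. f x = a})"
proof -
  have "(\<Sum>b\<in>UNIV. g (card {x\<in>W. f x = b}))
      = g (card {x\<in>W. f x = 0}) + (\<Sum>b\<in>UNIV - {0}. g (card {x\<in>W. f x = b}))"
    by (rule sum.remove) auto
  also have "(\<Sum>b\<in>UNIV - {0}. g (card {x\<in>W. f x = b}))
      = (\<Sum>b\<in>UNIV - {0 :: 'k}. g (card {x\<in>W. f x = a}))"
    by (intro sum.cong[OF refl] arg_cong[where f = g] card_value_eq[OF W \<open>a \<noteq> 0\<close>]) auto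
  also have "\<dots> = (int CARD('k) - 1) * g (card {x\<in>W. f x = a})"
    using CARD_field_gt_1[where 'k = 'k] by (simp add: card_Diff_singleton of_nat_diff)
  finally show ?thesis .
qed

lemma card_eq_sum_values: "(\<Sum>b\<in>UNIV. int (card {x\<in>W. f x = b})) = int (card W)"
proof -
  have "W = (\<Union>b. {x\<in>W. f x = b})" by auto
  then have "card W = card (\<Union>b. {x\<in>W. f x = b})" by (rule arg_cong)
  also have "\<dots> = (\<Sum>b\<in>UNIV. card {x\<in>W. f x = b})"
    by (rule card_UN_disjoint) auto
  finally show ?thesis by simp
qed

text \<open>
  Both sides count the pairs \<open>(x, x + z)\<close> in \<open>W \<times> W\<close> on which \<open>f\<close> agrees: the condition is
  \<open>f z = B x z\<close>, which for \<open>z\<close> outside the radical of \<open>W\<close> is an affine hyperplane in \<open>x\<close>.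
\<close>

lemma second_moment:
  assumes W: "subspace W"
  defines "R \<equiv> {z\<in>W. \<forall>x\<in>W. B x z = 0}"
  shows "int CARD('k) * (\<Sum>b\<in>UNIV. (int (card {x\<in>W. f x = b}))\<^sup>2)
    = int CARD('k) * card W * card {z\<in>R. f z = 0} + (int (card W) - int (card R)) * card W"
proof -
  let ?S = "\<Sum>b\<in>UNIV. (int (card {x\<in>W. f x = b}))\<^sup>2"
  have "{(x, y). x \<in> W \<and> y \<in> W \<and> f x = f y} = (\<Union>b. {x\<in>W. f x = b} \<times> {x\<in>W. f x = b})" by auto
  then have "card {(x, y). x \<in> W \<and> y \<in> W \<and> f x = f y} = card (\<Union>b. {x\<in>W. f x = b} \<times> {x\<in>W. f x = b})"
    by (rule arg_cong)
  also have "\<dots> = (\<Sum>b\<in>UNIV. card ({x\<in>W. f x = b} \<times> {x\<in>W. f x = b}))"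
    by (rule card_UN_disjoint) auto
  finally have S: "?S = int (card {(x, y). x \<in> W \<and> y \<in> W \<and> f x = f y})"
    by (simp add: power2_eq_square)
  have agree: "f x = f (x + z) \<longleftrightarrow> B x z = f z" for x z
  proof -
    have "f x = f (x + z) \<longleftrightarrow> f z + B x z = 0" by (simp add: f_add add.assoc)
    also have "\<dots> \<longleftrightarrow> B x z = - f z" using eq_neg_iff_add_eq_0[of "B x z" "f z"] by (simp add: add.commute)
    finally show ?thesis by (simp only: uminus_id)
  qed
  have "bij_betw (\<lambda>(z, x). (x, x + z)) {(z, x). z \<in> W \<and> x \<in> W \<and> B x z = f z}
      {(x, y). x \<in> W \<and> y \<in> W \<and> f x = f y}"
  proof (rule bij_betw_byWitness[where f' = "\<lambda>(x, y). (y - x, x)"])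
    have "B x (y - x) = f (y - x)" if "f x = f y" for x y
      using agree[of x "y - x"] that by simp
    then show "(\<lambda>(x, y). (y - x, x)) ` {(x, y). x \<in> W \<and> y \<in> W \<and> f x = f y}
        \<subseteq> {(z, x). z \<in> W \<and> x \<in> W \<and> B x z = f z}"
      using W by (auto simp: subspace_diff)
  qed (use W in \<open>auto simp: subspace_add agree\<close>)
  then have "?S = int (card {(z, x). z \<in> W \<and> x \<in> W \<and> B x z = f z})"
    unfolding S by (intro arg_cong[where f = int] bij_betw_same_card[symmetric])
  also have "\<dots> = (\<Sum>z\<in>W. int (card {x\<in>W. B x z = f z}))"
    by (subst card_pairs_eq_sum) simp_all
  finally have "int CARD('k) * ?S = (\<Sum>z\<in>W. int (CARD('k) * card {x\<in>W. B x z = f z}))"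
    by (simp add: sum_distrib_left)
  also have "\<dots> = (\<Sum>z\<in>W. if z \<in> R then (if f z = 0 then int (CARD('k) * card W) else 0) else int (card W))"
  proof (rule sum.cong[OF refl])
    fix z assume z: "z \<in> W"
    show "int (CARD('k) * card {x\<in>W. B x z = f z})
        = (if z \<in> R then (if f z = 0 then int (CARD('k) * card W) else 0) else int (card W))"
    proof (cases "z \<in> R")
      case True
      then have "{x\<in>W. B x z = f z} = (if f z = 0 then W else {})" by (auto simp: R_def)
      then show ?thesis using True by simp
    next
      case False
      then obtain x where "x \<in> W" "B x z \<noteq> 0" using z by (auto simp: R_def)
      then have "CARD('k) * card {x\<in>W. B x z = f z} = card W"
        by (intro card_fibre_linear[of W "\<lambda>x. B x z"] W) (auto simp: B_add_left B_scale_left)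
      then show ?thesis by (subst if_not_P[OF False]) simp
    qed
  qed
  also have "\<dots> = (\<Sum>z\<in>R. if f z = 0 then int (CARD('k) * card W) else 0) + (\<Sum>z\<in>W - R. int (card W))"
  proof -
    have "W \<inter> {z. z \<in> R} = R" "W \<inter> - {z. z \<in> R} = W - R" by (auto simp: R_def)
    then show ?thesis by (subst sum.If_cases) simp_all
  qed
  also have "(\<Sum>z\<in>R. if f z = 0 then int (CARD('k) * card W) else 0)
      = int (card {z\<in>R. f z = 0}) * int (CARD('k) * card W)"
    by (subst sum_if_card) simp_all
  also have "(\<Sum>z\<in>W - R. int (card W)) = (int (card W) - int (card R)) * card W"
    by (simp add: R_def card_Diff_subset of_nat_diff card_mono)
  finally show ?thesis by (simp add: mult_ac)
qed

text \<open>The first moment eliminates the number of zeros of \<open>f\<close>, and the second then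
  fixes the square of the deviation of \<open>CARD('k) * N\<close> from \<open>card W\<close>. If
  \<open>f\<close> is not zero on \<open>R\<close>, it is additive and onto there, so exactly one in
  \<open>CARD('k)\<close> elements of \<open>R\<close> is singular and the deviation
  vanishes.\<close>

lemma card_value_dichotomy:
  assumes W: "subspace W" and a: "a \<noteq> 0"
  defines "R \<equiv> {z\<in>W. \<forall>x\<in>W. B x z = 0}"
  defines "N \<equiv> card {x\<in>W. f x = a}"
  shows "CARD('k) * N = card W \<or>
    (\<forall>z\<in>R. f z = 0) \<and> (int CARD('k) * N - card W)\<^sup>2 = int (card W) * card R"
proof -
  let ?q = "int CARD('k)" and ?N = "int N" and ?Z = "int (card {x\<in>W. f x = 0})"
  have q: "?q - 1 \<noteq> 0" using CARD_field_gt_1[where 'k = 'k] by simp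
  have Z: "?Z = int (card W) - (?q - 1) * ?N"
    using sum_card_values[OF W a, of int] card_eq_sum_values[of W] by (simp add: N_def)
  have "?q * (?Z\<^sup>2 + (?q - 1) * ?N\<^sup>2)
      = ?q * card W * card {z\<in>R. f z = 0} + (int (card W) - int (card R)) * card W"
    using second_moment[OF W] sum_card_values[OF W a, of "\<lambda>n. (int n)\<^sup>2"] by (simp add: N_def R_def)
  then have key: "(?q - 1) * (?q * ?N - card W)\<^sup>2 = card W * (?q * card {z\<in>R. f z = 0} - card R)"
    unfolding Z by (simp add: algebra_simps power2_eq_square)
  show ?thesis
  proof (cases "\<forall>z\<in>R. f z = 0")
    case True
    then have "{z\<in>R. f z = 0} = R" by auto
    then have "(?q - 1) * (?q * ?N - card W)\<^sup>2 = (?q - 1) * (int (card W) * card R)"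
      using key by (simp add: algebra_simps)
    then show ?thesis using True q mult_left_cancel by blast
  next
    case False
    then obtain u where u: "u \<in> R" "f u \<noteq> 0" by blast
    have R: "subspace R" unfolding R_def by (rule subspace_perp[OF W])
    have "CARD('k) * card {z\<in>R. f z = 0} = card R"
    proof (rule card_fibre_additive[OF R])
      show "f (x + y) = f x + f y" if "x \<in> R" "y \<in> R" for x y
        using that by (simp add: f_add R_def)
      show "\<exists>w\<in>R. f w = c" for c
      proof -
        obtain d where "d\<^sup>2 = c / f u" using char2_square_surj[OF char2] by blast
        then have "f (d *s u) = c" using u by (simp add: f_scale)
        then show ?thesis using subspace_scale[OF R u(1)] by blast
      qed
    qed
    then have "?q * card {z\<in>R. f z = 0} - card R = 0"
      unfolding of_nat_mult[symmetric] by simp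
    then have "(?q - 1) * (?q * ?N - card W)\<^sup>2 = 0" using key by simp
    then have "?q * ?N - card W = 0" using q by (simp only: mult_eq_0_iff power_eq_0_iff) simp
    then have "int (CARD('k) * N) = int (card W)" by simp
    then have "CARD('k) * N = card W" unfolding of_nat_eq_iff .
    then show ?thesis ..
  qed
qed

text \<open>By \<open>card_E\<close> and \<open>aniso\<close>, \<open>f\<close> behaves on
  \<open>E\<close> like an anisotropic plane with every vector repeated \<open>card T\<close> times,
  so each non-zero value is taken \<open>(CARD('k) + 1) * card T\<close> times. Outside
  \<open>E\<close> the linear map \<open>B x\<close> is not zero on \<open>T\<close>, so translating
  by \<open>T\<close> spreads the values evenly.\<close>

lemma card_value_by_singular_subspace:
  assumes W: "subspace W" and T: "subspace T" and "T \<subseteq> W" and a: "a \<noteq> 0"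
    and sing: "\<And>t. t \<in> T \<Longrightarrow> f t = 0"
  defines "E \<equiv> {x\<in>W. \<forall>t\<in>T. B t x = 0}"
  assumes card_E: "card E = (CARD('k))\<^sup>2 * card T"
    and aniso: "\<And>x. x \<in> E \<Longrightarrow> f x = 0 \<Longrightarrow> x \<in> T"
  shows "CARD('k) * card {x\<in>W. f x = a} = card W + CARD('k) * card T"
proof -
  let ?q = "int CARD('k)"
  have q: "?q - 1 \<noteq> 0" using CARD_field_gt_1[where 'k = 'k] by simp
  have E: "subspace E" unfolding E_def by (rule subspace_perp[OF W])
  have BT: "B t t' = 0" if "t \<in> T" "t' \<in> T" for t t'
    using f_add[of t t'] that sing T by (simp add: subspace_add)
  have "T \<subseteq> E" using \<open>T \<subseteq> W\<close> BT by (auto simp: E_def)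
  then have "{x\<in>E. f x = 0} = T" using sing aniso by auto
  then have "int (card T) + (?q - 1) * card {x\<in>E. f x = a} = ?q\<^sup>2 * card T"
    using sum_card_values[OF E a, of int] card_eq_sum_values[of E] card_E by simp
  then have "(?q - 1) * card {x\<in>E. f x = a} = (?q - 1) * ((?q + 1) * card T)"
    by (simp add: algebra_simps power2_eq_square)
  then have NE: "int (card {x\<in>E. f x = a}) = (?q + 1) * card T"
    using q mult_left_cancel by blast
  \<comment> \<open>\<open>W - E\<close> is stable under translation by \<open>T\<close>, so
    averaging over \<open>t\<close> does not change the count; the pairs counted below carry out
    this average.\<close>
  have shift: "card {x\<in>W - E. f (x + t) = a} = card {x\<in>W - E. f x = a}" if t: "t \<in> T" for t
  proof -
    have tE: "t \<in> E" using t \<open>T \<subseteq> E\<close> by auto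
    have plus: "x + t \<in> W - E" if "x \<in> W - E" for x
    proof -
      have "x + t \<notin> E" using subspace_diff[OF E, of "x + t" t] tE that by auto
      then show ?thesis using that W tE by (auto simp: E_def subspace_add)
    qed
    have minus: "x - t \<in> W - E" if "x \<in> W - E" for x
    proof -
      have "x - t \<notin> E" using subspace_add[OF E, of "x - t" t] tE that by auto
      then show ?thesis using that W tE by (auto simp: E_def subspace_diff)
    qed
    have "bij_betw (\<lambda>x. x + t) {x\<in>W - E. f (x + t) = a} {x\<in>W - E. f x = a}"
      by (rule bij_betw_byWitness[where f' = "\<lambda>x. x - t"]) (use plus minus in auto)
    then show ?thesis by (rule bij_betw_same_card)
  qed
  let ?P = "card {(x, t). x \<in> W - E \<and> t \<in> T \<and> f (x + t) = a}"
  have "?P = card {(t, x). t \<in> T \<and> x \<in> W - E \<and> f (x + t) = a}"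
    by (intro bij_betw_same_card[of prod.swap]) (auto simp: bij_betw_def inj_on_def image_def)
  also have "\<dots> = (\<Sum>t\<in>T. card {x\<in>W - E. f (x + t) = a})"
    by (rule card_pairs_eq_sum) simp_all
  also have "\<dots> = card T * card {x\<in>W - E. f x = a}"
    by (subst sum.cong[OF refl shift]) simp_all
  finally have P1: "?P = card T * card {x\<in>W - E. f x = a}" .
  have "CARD('k) * ?P = (\<Sum>x\<in>W - E. CARD('k) * card {t\<in>T. f (x + t) = a})"
    by (subst card_pairs_eq_sum) (simp_all add: sum_distrib_left)
  also have "\<dots> = (\<Sum>x\<in>W - E. card T)"
  proof (rule sum.cong[OF refl])
    fix x assume "x \<in> W - E"
    then obtain t where "t \<in> T" "B x t \<noteq> 0" by (auto simp: E_def B_sym)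
    then have "CARD('k) * card {t\<in>T. B x t = a - f x} = card T"
      by (intro card_fibre_linear[of T "B x"] T) (auto simp: B_add_right B_scale_right)
    moreover have "{t\<in>T. f (x + t) = a} = {t\<in>T. B x t = a - f x}"
      by (auto simp: f_add sing eq_diff_eq add.commute[of _ "f x"])
    ultimately show "CARD('k) * card {t\<in>T. f (x + t) = a} = card T" by simp
  qed
  also have "\<dots> = card T * card (W - E)" by simp
  finally have "card T * (CARD('k) * card {x\<in>W - E. f x = a}) = card T * card (W - E)"
    unfolding P1 by (simp add: mult_ac)
  moreover have "card T \<noteq> 0" using subspace_0[OF T] by auto
  ultimately have out: "CARD('k) * card {x\<in>W - E. f x = a} = card (W - E)" by simp
  have "E \<subseteq> W" by (auto simp: E_def)
  have "{x\<in>W. f x = a} = {x\<in>E. f x = a} \<union> {x\<in>W - E. f x = a}" using \<open>E \<subseteq> W\<close> by auto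
  then have "card {x\<in>W. f x = a} = card {x\<in>E. f x = a} + card {x\<in>W - E. f x = a}"
    by (simp only:) (rule card_Un_disjoint, auto)
  then have "?q * card {x\<in>W. f x = a} = ?q * ((?q + 1) * card T) + int (CARD('k) * card {x\<in>W - E. f x = a})"
    using NE by (simp add: distrib_left)
  also have "\<dots> = ?q * ((?q + 1) * card T) + (card W - ?q\<^sup>2 * card T)"
    using \<open>E \<subseteq> W\<close> card_mono[OF finite \<open>E \<subseteq> W\<close>]
    by (simp only: out) (simp add: card_Diff_subset of_nat_diff card_E)
  also have "\<dots> = card W + ?q * card T" by (simp add: algebra_simps power2_eq_square)
  finally show ?thesis unfolding of_nat_mult[symmetric] of_nat_add[symmetric] of_nat_eq_iff .
qed

text \<open>If \<open>f\<close> vanishes on \<open>R = W\<close>, the level set is empty. If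
  \<open>R\<close> is a proper subspace, its codimension is at least 2 because \<open>B\<close> is
  alternating; this bounds the square in \<open>card_value_dichotomy\<close> by that of
  \<open>card W / CARD('k)\<close>.\<close>

lemma card_value_le_small:
  assumes W: "subspace W" and a: "a \<noteq> 0"
  shows "(CARD('k))\<^sup>2 * card {x\<in>W. f x = a} \<le> (CARD('k) + 1) * card W"
proof -
  define R where "R = {z\<in>W. \<forall>x\<in>W. B x z = 0}"
  let ?d = "int CARD('k) * card {x\<in>W. f x = a} - card W"
  consider (bal) "CARD('k) * card {x\<in>W. f x = a} = card W"
    | (all) "\<forall>z\<in>R. f z = 0" "R = W"
    | (rad) w where "?d\<^sup>2 = int (card W) * card R" "w \<in> W" "w \<notin> R"
    using card_value_dichotomy[OF W a] unfolding R_def by blast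
  then show ?thesis
  proof cases
    case bal
    then have "(CARD('k))\<^sup>2 * card {x\<in>W. f x = a} = CARD('k) * card W"
      by (simp add: power2_eq_square mult.assoc)
    then show ?thesis by simp
  next
    case all
    then have "{x\<in>W. f x = a} = {}" using a by auto
    then show ?thesis by (simp only: card.empty mult_0_right le0)
  next
    case rad
    define q where "q = CARD('k)"
    \<comment> \<open>\<open>X\<close> is a hyperplane of \<open>W\<close> containing
      \<open>R\<close>, and also \<open>w\<close> since \<open>B w w = 0\<close>; hence it lies
      strictly between \<open>R\<close> and \<open>W\<close>.\<close>
    define X where "X = {x\<in>W. B w x = 0}"
    have X: "subspace X" using subspace_perp[OF W, of "{w}"] by (simp add: X_def)
    have R: "subspace R" unfolding R_def by (rule subspace_perp[OF W])
    have "R \<subseteq> X" using rad(2) by (auto simp: X_def R_def)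
    moreover have "w \<in> X" using rad(2) by (simp add: X_def B_self)
    ultimately have 1: "q * card R \<le> card X"
      unfolding q_def using rad(3) by (intro card_subspace_less[OF R X])
    obtain x where "x \<in> W" "B w x \<noteq> 0" using rad(2,3) by (auto simp: R_def B_sym)
    then have 2: "q * card X = card W"
      unfolding X_def q_def by (intro card_fibre_linear[OF W]) (simp_all add: B_add_right B_scale_right)
    have "q\<^sup>2 * card R = q * (q * card R)" by (simp add: power2_eq_square)
    also have "\<dots> \<le> card W" unfolding 2[symmetric] using 1 by simp
    finally have "card W * (q\<^sup>2 * card R) \<le> card W * card W" by (rule mult_left_mono) simp
    then have "int (card W * (q\<^sup>2 * card R)) \<le> int (card W * card W)" unfolding of_nat_le_iff .
    moreover have "(int q * ?d)\<^sup>2 = int (card W * (q\<^sup>2 * card R))"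
      unfolding power_mult_distrib rad(1) by simp
    moreover have "int (card W * card W) = (int (card W))\<^sup>2" by (simp add: power2_eq_square)
    ultimately have "(int q * ?d)\<^sup>2 \<le> (int (card W))\<^sup>2" by (simp only:)
    then have "int q * ?d \<le> int (card W)" by (rule power2_le_imp_le) simp
    then have "int (q\<^sup>2 * card {x\<in>W. f x = a}) \<le> int ((q + 1) * card W)"
      by (simp add: q_def algebra_simps power2_eq_square)
    then show ?thesis unfolding of_nat_le_iff q_def .
  qed
qed

end

section \<open>Forms of type III\<close>

text \<open>Coordinates are given as linear functionals rather than by a basis, which makes it easy
  to compose them with a linear map or to alter a single one.\<close>

locale coordinates = finite_vector_space scale
  for scale :: "'k::{field,finite} \<Rightarrow> 'v::{ab_group_add,finite} \<Rightarrow> 'v" (infixr \<open>*s\<close> 75) +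
  fixes y :: "nat \<Rightarrow> 'v \<Rightarrow> 'k" and m :: nat
  assumes y_add: "y i (x + z) = y i x + y i z"
    and y_scale: "y i (c *s x) = c * y i x"
    and y_inj: "(\<And>i. i \<in> {1..m} \<Longrightarrow> y i x = 0) \<Longrightarrow> x = 0"
    and card_space: "CARD('v) = CARD('k) ^ m"
begin

lemma y_zero: "y i 0 = 0"
  using y_scale[of i 0 0] by simp

lemma y_diff: "y i (x - z) = y i x - y i z"
  using y_add[of i "x - z" z] by simp

lemma y_eqI: "(\<And>i. i \<in> {1..m} \<Longrightarrow> y i x = y i z) \<Longrightarrow> x = z"
  using y_inj[of "x - z"] by (simp add: y_diff)

text \<open>The coordinate map is injective between sets of equal size \<open>CARD('k) ^ m\<close>,
  hence onto.\<close>

lemma coordinates_exist: "\<exists>x. \<forall>i\<in>{1..m}. y i x = c i"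
proof -
  let ?\<Phi> = "\<lambda>x. restrict (\<lambda>i. y i x) {1..m}"
  have "inj ?\<Phi>"
  proof (rule injI)
    fix x z assume "?\<Phi> x = ?\<Phi> z"
    then have "y i x = y i z" if "i \<in> {1..m}" for i using that by (metis restrict_apply')
    then show "x = z" by (rule y_eqI)
  qed
  then have "card (range ?\<Phi>) = card (PiE {1..m} (\<lambda>_. UNIV :: 'k set))"
    by (simp add: card_image card_space card_PiE)
  then have "range ?\<Phi> = PiE {1..m} (\<lambda>_. UNIV)"
    by (intro card_subset_eq) (auto intro: finite_PiE)
  then have "restrict c {1..m} \<in> range ?\<Phi>" by simp
  then obtain x where "restrict c {1..m} = ?\<Phi> x" by auto
  then show ?thesis by (metis restrict_apply')
qed

definition coordinate_subspace :: "nat set \<Rightarrow> 'v set" where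
  "coordinate_subspace I = {x. \<forall>i\<in>{1..m} - I. y i x = 0}"

lemma subspace_coordinate_subspace: "subspace (coordinate_subspace I)"
  by (auto simp: subspace_def coordinate_subspace_def y_zero y_add y_scale)

lemma card_coordinate_subspace:
  assumes "I \<subseteq> {1..m}"
  shows "card (coordinate_subspace I) = CARD('k) ^ card I"
proof -
  have "finite I" using assms finite_subset by blast
  let ?\<Phi> = "\<lambda>x. restrict (\<lambda>i. y i x) I"
  have "bij_betw ?\<Phi> (coordinate_subspace I) (PiE I (\<lambda>_. UNIV))"
    unfolding bij_betw_def
  proof
    show "inj_on ?\<Phi> (coordinate_subspace I)"
    proof (rule inj_onI)
      fix x z assume xz: "x \<in> coordinate_subspace I" "z \<in> coordinate_subspace I" and "?\<Phi> x = ?\<Phi> z"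
      then have I: "y i x = y i z" if "i \<in> I" for i using that by (metis restrict_apply')
      show "x = z"
      proof (rule y_eqI)
        fix i assume "i \<in> {1..m}"
        then show "y i x = y i z"
          using xz I by (cases "i \<in> I") (simp_all add: coordinate_subspace_def)
      qed
    qed
    show "?\<Phi> ` coordinate_subspace I = PiE I (\<lambda>_. UNIV)"
    proof (intro equalityI subsetI)
      fix g :: "nat \<Rightarrow> 'k" assume g: "g \<in> PiE I (\<lambda>_. UNIV)"
      obtain x where x: "\<forall>i\<in>{1..m}. y i x = (if i \<in> I then g i else 0)"
        using coordinates_exist[of "\<lambda>i. if i \<in> I then g i else 0"] by (rule exE)
      have "g = ?\<Phi> x"
      proof
        fix i show "g i = ?\<Phi> x i"
        proof (cases "i \<in> I")
          case True
          then show ?thesis using x assms by (simp add: subset_iff)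
        next
          case False
          then show ?thesis using PiE_arb[OF g] by simp
        qed
      qed
      moreover have "x \<in> coordinate_subspace I" using x by (auto simp: coordinate_subspace_def)
      ultimately show "g \<in> ?\<Phi> ` coordinate_subspace I" by blast
    qed auto
  qed
  then have "card (coordinate_subspace I) = card (PiE I (\<lambda>_. UNIV :: 'k set))"
    by (rule bij_betw_same_card)
  then show ?thesis using \<open>finite I\<close> by (simp add: card_PiE)
qed

end

text \<open>The map \<open>t\<^sup>2 + t\<close> sends both 0 and 1 to 0, so on a finite field it
  cannot be onto.\<close>

lemma ex_not_artin_schreier_value:
  assumes "(1 :: 'k::{field,finite}) + 1 = 0"
  shows "\<exists>c :: 'k. \<forall>t. c \<noteq> t\<^sup>2 + t"
proof (rule ccontr)
  assume "\<not> ?thesis"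
  then have "\<forall>c :: 'k. \<exists>t. c = t\<^sup>2 + t" by blast
  then have "surj (\<lambda>t :: 'k. t\<^sup>2 + t)" by (simp add: surj_def)
  then have "inj (\<lambda>t :: 'k. t\<^sup>2 + t)" by (rule finite_UNIV_surj_inj[OF finite])
  then show False using injD[of "\<lambda>t :: 'k. t\<^sup>2 + t" 0 1] assms by simp
qed

section \<open>The normal form, its polar form and the radical\<close>

locale type_III_space = coordinates scale y m
  for scale :: "'k::{field,finite} \<Rightarrow> 'v::{ab_group_add,finite} \<Rightarrow> 'v" (infixr \<open>*s\<close> 75)
    and y :: "nat \<Rightarrow> 'v \<Rightarrow> 'k" and m :: nat +
  fixes s :: nat
  assumes char2': "(1 :: 'k) + 1 = 0"
    and s_pos: "1 \<le> s" and s_less: "2 * s + 1 < m"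
begin

definition F :: "'v \<Rightarrow> 'k" where
  "F x = (\<Sum>i=1..s. y (2 * i - 1) x * y (2 * i) x) + (y (2 * s + 1) x)\<^sup>2"

definition B :: "'v \<Rightarrow> 'v \<Rightarrow> 'k" where
  "B x z = (\<Sum>i=1..s. y (2 * i - 1) x * y (2 * i) z + y (2 * i) x * y (2 * i - 1) z)"

sublocale quadratic_space scale F B
proof
  show "(1 :: 'k) + 1 = 0" by (rule char2')
  fix c x z w
  show "F (c *s x) = c\<^sup>2 * F x"
    by (simp add: F_def y_scale sum_distrib_left power2_eq_square algebra_simps)
  show "F (x + z) = F x + F z + B x z"
  proof -
    \<comment> \<open>Squaring is additive, so the last term of \<open>F\<close> contributes nothing
      to \<open>B\<close>.\<close>
    have "(u + v)\<^sup>2 = u\<^sup>2 + v\<^sup>2" for u v :: 'k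
    proof -
      have "(2 :: 'k) = 0" using char2' by (simp only: one_add_one)
      then show ?thesis by (simp add: power2_sum)
    qed
    then show ?thesis
      by (simp add: F_def B_def y_add algebra_simps sum.distrib)
  qed
  show "B (x + z) w = B x w + B z w"
    by (simp add: B_def y_add algebra_simps sum.distrib)
  show "B (c *s x) w = c * B x w"
    by (simp add: B_def y_scale algebra_simps sum_distrib_left)
qed

text \<open>Coordinates \<open>2 * i - 1\<close> and \<open>2 * i\<close> form a hyperbolic pair, so
  pairing with one unit vector reads off the partner coordinate. Only the first \<open>2 * s\<close>
  coordinates of \<open>x\<close> are prescribed, since no others enter \<open>B\<close>.\<close>

lemma B_unit_even:
  assumes i: "i \<in> {1..s}" and "\<And>j. j \<in> {1..2 * s} \<Longrightarrow> y j x = (if j = 2 * i then 1 else 0)"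
  shows "B x w = y (2 * i - 1) w"
proof -
  have "B x w = (\<Sum>j=1..s. if j = i then y (2 * i - 1) w else 0)"
    unfolding B_def
  proof (rule sum.cong[OF refl])
    fix j assume j: "j \<in> {1..s}"
    have "2 * j - 1 \<noteq> 2 * i" "2 * j - 1 \<in> {1..2 * s}" using j by auto presburger+
    moreover have "2 * j \<in> {1..2 * s}" using j by simp
    ultimately have "y (2 * j) x = (if j = i then 1 else 0)" "y (2 * j - 1) x = 0"
      using assms(2)[of "2 * j"] assms(2)[of "2 * j - 1"] by auto
    then show "y (2 * j - 1) x * y (2 * j) w + y (2 * j) x * y (2 * j - 1) w
        = (if j = i then y (2 * i - 1) w else 0)" by simp
  qed
  then show ?thesis using i by simp
qed

lemma B_unit_odd:
  assumes i: "i \<in> {1..s}" and "\<And>j. j \<in> {1..2 * s} \<Longrightarrow> y j x = (if j = 2 * i - 1 then 1 else 0)"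
  shows "B x w = y (2 * i) w"
proof -
  have "B x w = (\<Sum>j=1..s. if j = i then y (2 * i) w else 0)"
    unfolding B_def
  proof (rule sum.cong[OF refl])
    fix j assume j: "j \<in> {1..s}"
    have "2 * j \<noteq> 2 * i - 1" using i by auto presburger
    moreover have "2 * j - 1 = 2 * i - 1 \<longleftrightarrow> j = i" using i j by auto
    moreover have "2 * j \<in> {1..2 * s}" "2 * j - 1 \<in> {1..2 * s}" using j by auto
    ultimately show "y (2 * j - 1) x * y (2 * j) w + y (2 * j) x * y (2 * j - 1) w
        = (if j = i then y (2 * i) w else 0)"
      using assms(2)[of "2 * j"] assms(2)[of "2 * j - 1"] by (cases "j = i") simp_all
  qed
  then show ?thesis using i by simp
qed

lemma radical_coordinates:
  assumes w: "\<forall>x. B x w = 0" and i: "i \<in> {1..2 * s}"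
  shows "y i w = 0"
proof (cases "even i")
  case True
  then obtain k where k: "i = 2 * k" by blast
  obtain x where "\<forall>j\<in>{1..m}. y j x = (if j = 2 * k - 1 then 1 else 0)"
    using coordinates_exist[of "\<lambda>j. if j = 2 * k - 1 then 1 else 0"] by (rule exE)
  then have "B x w = y (2 * k) w"
    using i k s_less by (intro B_unit_odd) auto
  then show ?thesis using w k by simp
next
  case False
  then obtain k where k: "i = 2 * k + 1" by (metis oddE)
  obtain x where "\<forall>j\<in>{1..m}. y j x = (if j = 2 * (k + 1) then 1 else 0)"
    using coordinates_exist[of "\<lambda>j. if j = 2 * (k + 1) then 1 else 0"] by (rule exE)
  then have "B x w = y (2 * (k + 1) - 1) w"
    using i k s_less by (intro B_unit_even) auto
  then show ?thesis using w k by simp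
qed

text \<open>The unit vector of index \<open>2 * s + 1\<close> works. It makes the level sets of the
  whole space equally large and supplies a factor \<open>CARD('k)\<close> in the upper
  bound.\<close>

lemma ex_nonsingular_radical: "\<exists>e. F e = 1 \<and> (\<forall>x. B e x = 0)"
proof -
  obtain e where e: "\<forall>j\<in>{1..m}. y j e = (if j = 2 * s + 1 then 1 else 0)"
    using coordinates_exist[of "\<lambda>j. if j = 2 * s + 1 then 1 else 0"] by (rule exE)
  have z: "y (2 * i) e = 0" "y (2 * i - 1) e = 0" if "i \<in> {1..s}" for i
  proof -
    have "2 * i \<in> {1..m}" "2 * i - 1 \<in> {1..m}" "2 * i \<noteq> 2 * s + 1" "2 * i - 1 \<noteq> 2 * s + 1"
      using that s_less by auto
    then show "y (2 * i) e = 0" "y (2 * i - 1) e = 0" using e by auto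
  qed
  have "F e = 1" using z e s_less by (simp add: F_def)
  moreover have "B e x = 0" for x using z by (simp add: B_def)
  ultimately show ?thesis by blast
qed

text \<open>On the radical of \<open>B\<close> the form is the square of coordinate
  \<open>2 * s + 1\<close>, so singular vectors there have only the coordinates beyond that index
  free.\<close>

lemma card_singular_radical_le:
  assumes "\<And>x. x \<in> S \<Longrightarrow> F x = 0" "\<And>x z. x \<in> S \<Longrightarrow> B z x = 0"
  shows "card S \<le> CARD('k) ^ (m - 2 * s - 1)"
proof -
  have "S \<subseteq> coordinate_subspace {2 * s+2..m}"
  proof
    fix x assume x: "x \<in> S"
    have y: "y i x = 0" if "i \<in> {1..2 * s}" for i
      using radical_coordinates[OF _ that] assms(2)[OF x] by blast
    have "F x = (y (2 * s + 1) x)\<^sup>2" unfolding F_def using y by simp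
    then have "y (2 * s + 1) x = 0" using assms(1)[OF x] by simp
    have "y i x = 0" if "i \<in> {1..m} - {2 * s+2..m}" for i
    proof (cases "i = 2 * s + 1")
      case False
      then show ?thesis using that by (intro y) auto
    qed (use \<open>y (2 * s + 1) x = 0\<close> in simp)
    then show "x \<in> coordinate_subspace {2 * s+2..m}" unfolding coordinate_subspace_def by blast
  qed
  then have "card S \<le> card (coordinate_subspace {2 * s+2..m})" by (simp add: card_mono)
  also have "\<dots> = CARD('k) ^ (m - 2 * s - 1)"
    by (subst card_coordinate_subspace) auto
  finally show ?thesis .
qed

text \<open>In the unbalanced case the orthogonal space \<open>P\<close> of \<open>W\<close>
  contains \<open>R\<close>, and also the radical vector \<open>e\<close>, which is outside
  \<open>R\<close> as \<open>F e = 1\<close>. So \<open>q * card R\<close> is at most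
  \<open>card P\<close>, while \<open>card_orthogonal\<close> expresses
  \<open>card P * card W\<close> through the singular radical vectors in \<open>W\<close>. Together
  this bounds \<open>card W * card R\<close>.\<close>

lemma card_value_le_large:
  assumes W: "subspace W" and a: "a \<noteq> 0"
  shows "CARD('k) * card {x\<in>W. F x = a} \<le> card W + CARD('k) ^ (m - s - 1)"
proof -
  define R where "R = {z\<in>W. \<forall>x\<in>W. B x z = 0}"
  define P where "P = {x. \<forall>w\<in>W. B x w = 0}"
  define q where "q = CARD('k)"
  let ?d = "int CARD('k) * card {x\<in>W. F x = a} - card W"
  consider "CARD('k) * card {x\<in>W. F x = a} = card W"
    | "\<forall>z\<in>R. F z = 0" "?d\<^sup>2 = int (card W) * card R"
    using card_value_dichotomy[OF W a] unfolding R_def by blast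
  then show ?thesis
  proof cases
    case 2
    obtain e where e: "F e = 1" "\<forall>x. B e x = 0" using ex_nonsingular_radical by blast
    have P: "subspace P" by (auto simp: P_def subspace_def B_add_left B_scale_left B_zero)
    have "R \<subseteq> P" by (auto simp: R_def P_def B_sym)
    then have RP: "q * card R \<le> card P"
      unfolding q_def using e 2(1)
      by (intro card_subspace_less[of R P e] P) (auto simp: P_def R_def intro: subspace_perp W)
    let ?S = "{w\<in>W. \<forall>x. B x w = 0}"
    have PW: "card P * card W = q ^ m * card ?S"
      unfolding P_def q_def card_space[symmetric]
      by (intro card_orthogonal W) (simp_all add: B_add_left B_scale_left B_add_right B_scale_right)
    have S: "card ?S \<le> q ^ (m - 2 * s - 1)"
      unfolding q_def using 2(1) by (intro card_singular_radical_le) (auto simp: R_def)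
    have q: "q > 0" unfolding q_def by simp
    have "q * (card W * card R) = (q * card R) * card W" by (simp add: mult_ac)
    also have "\<dots> \<le> card P * card W" using RP by (rule mult_right_mono) simp
    also have "\<dots> \<le> q ^ m * q ^ (m - 2 * s - 1)" unfolding PW using S by simp
    also have "\<dots> = q ^ (m + (m - 2 * s - 1))" by (simp add: power_add)
    \<comment> \<open>The exponent is odd; splitting off the factor \<open>q\<close> gained from
      \<open>e\<close> leaves a perfect square.\<close>
    also have "m + (m - 2 * s - 1) = Suc (2 * (m - s - 1))" using s_less by simp
    also have "q ^ Suc (2 * (m - s - 1)) = q * (q ^ (m - s - 1))\<^sup>2" by (simp add: power_mult[symmetric] mult.commute)
    finally have "card W * card R \<le> (q ^ (m - s - 1))\<^sup>2" using q by simp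
    then have "int (card W * card R) \<le> int ((q ^ (m - s - 1))\<^sup>2)" unfolding of_nat_le_iff .
    then have "?d\<^sup>2 \<le> (int (q ^ (m - s - 1)))\<^sup>2" using 2(2) by simp
    then have "?d \<le> int (q ^ (m - s - 1))" by (rule power2_le_imp_le) simp
    then have "int (CARD('k) * card {x\<in>W. F x = a}) \<le> int (card W + q ^ (m - s - 1))" by simp
    then show ?thesis unfolding of_nat_le_iff q_def .
  qed simp
qed

section \<open>Subspaces attaining the bounds\<close>

text \<open>One index from each hyperbolic pair except the first, together with the indices absent
  from \<open>F\<close>: these coordinates span a totally singular subspace. The first pair and
  index \<open>2 * s + 1\<close> are reserved for an anisotropic plane.\<close>

abbreviation core_indices :: "nat set" where
  "core_indices \<equiv> (\<lambda>i. 2 * i) ` {2..s} \<union> {2 * s + 2..m}"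

lemma card_core_indices: "card core_indices = m - s - 2"
proof -
  have "card core_indices = card ((\<lambda>i. 2 * i) ` {2..s}) + card {2 * s + 2..m}"
    by (rule card_Un_disjoint) auto
  also have "\<dots> = (s - 1) + (m - 2 * s - 1)"
    using s_pos by (simp add: card_image inj_on_def)
  finally show ?thesis using s_pos s_less by simp
qed

lemma core_indices_subset: "core_indices \<subseteq> {3..m} - {2 * s + 1}"
proof
  fix i assume "i \<in> core_indices"
  then consider j where "i = 2 * j" "2 \<le> j" "j \<le> s" | "2 * s + 2 \<le> i" "i \<le> m" by auto
  then show "i \<in> {3..m} - {2 * s + 1}"
  proof cases
    case 1
    moreover have "2 * j \<noteq> 2 * s + 1" by presburger
    ultimately show ?thesis using s_less by auto
  next
    case 2
    then show ?thesis using s_pos by auto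
  qed
qed

text \<open>
  Replacing the coordinate \<open>y (2 * s + 1)\<close> by \<open>z = y (2 * s + 1) + l * y 1 + y 2\<close>, the restriction
  of the form to \<open>z = 0\<close> contains the binary form \<open>l\<^sup>2 * y 1\<^sup>2 + y 1 * y 2 + y 2\<^sup>2\<close>, which is
  anisotropic when \<open>l\<^sup>2\<close> is not of the form \<open>t\<^sup>2 + t\<close>.
\<close>

lemma ex_subspace_many_values:
  assumes J: "J \<subseteq> {3..m} - {2 * s + 1}" and chain: "core_indices \<subseteq> J \<or> J \<subseteq> core_indices"
    and a: "a \<noteq> 0"
  shows "\<exists>W. subspace W \<and> card W = CARD('k) ^ (card J + 2) \<and>
    CARD('k) * card {x\<in>W. F x = a} = card W + CARD('k) * CARD('k) ^ card (J \<inter> core_indices)"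
proof -
  obtain c :: 'k where c: "\<forall>t. c \<noteq> t\<^sup>2 + t" using ex_not_artin_schreier_value[OF char2] by blast
  obtain l where l: "l\<^sup>2 = c" using char2_square_surj[OF char2] by blast
  define y' where "y' i x = (if i = 2 * s + 1 then y i x + (l * y 1 x + y 2 x) else y i x)" for i x
  have small: "y' i = y i" if "i \<noteq> 2 * s + 1" for i using that by (simp add: y'_def fun_eq_iff)
  interpret Y: coordinates scale y' m
  proof
    fix x assume z: "\<And>i. i \<in> {1..m} \<Longrightarrow> y' i x = 0"
    show "x = 0"
    proof (rule y_inj)
      fix i assume i: "i \<in> {1..m}"
      have "y 1 x = 0" "y 2 x = 0" using z[of 1] z[of 2] s_pos s_less by (simp_all add: y'_def)
      then show "y i x = 0" using z[OF i] by (simp add: y'_def split: if_splits)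
    qed
  qed (simp_all add: y'_def y_add y_scale card_space algebra_simps)
  let ?J = "J \<inter> core_indices"
  \<comment> \<open>As \<open>2 * s + 1\<close> is not in \<open>J\<close>, the altered coordinate
    vanishes on \<open>W\<close>. \<open>T\<close> is the totally singular part, and
    \<open>E\<close> its orthogonal space in \<open>W\<close>.\<close>
  define W where "W = Y.coordinate_subspace ({1, 2} \<union> J)"
  define T where "T = Y.coordinate_subspace ?J"
  define E where "E = {x\<in>W. \<forall>t\<in>T. B t x = 0}"
  have J3: "3 \<le> i" "i \<le> m" "i \<noteq> 2 * s + 1" if "i \<in> J" for i using that J by auto
  have "finite J" using J finite_subset by blast
  have card_ins: "card ({1, 2} \<union> I) = card I + 2" if "I \<subseteq> J" for I
  proof -
    have "finite I" using that \<open>finite J\<close> by (rule finite_subset)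
    moreover have "{1, 2} \<inter> I = {}" using that J3 by fastforce
    ultimately show ?thesis by (subst card_Un_disjoint) auto
  qed
  have sub: "{1, 2} \<union> J \<subseteq> {1..m}" "?J \<subseteq> {1..m}" "{1, 2} \<union> ?J \<subseteq> {1..m}"
    using J s_less by auto
  have W: "subspace W" and T: "subspace T"
    unfolding W_def T_def by (rule Y.subspace_coordinate_subspace)+
  have "T \<subseteq> W" by (auto simp: T_def W_def Y.coordinate_subspace_def)
  have card_W: "card W = CARD('k) ^ (card J + 2)"
    unfolding W_def Y.card_coordinate_subspace[OF sub(1)] by (subst card_ins) simp_all
  have card_T: "card T = CARD('k) ^ card ?J"
    unfolding T_def by (rule Y.card_coordinate_subspace[OF sub(2)])
  \<comment> \<open>The first two coordinates vanish on \<open>T\<close>, so old and new coordinates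
    agree there.\<close>
  have coT: "y i t = 0" if "t \<in> T" "i \<in> {1..m}" "i \<notin> ?J" for i t
  proof -
    have y': "y' j t = 0" if "j \<in> {1..m} - ?J" for j
      using \<open>t \<in> T\<close> that by (simp only: T_def Y.coordinate_subspace_def) blast
    have "1 \<notin> ?J" "2 \<notin> ?J" using J3 by fastforce+
    then have "y 1 t = 0" "y 2 t = 0" using y'[of 1] y'[of 2] s_pos s_less by (simp_all add: small)
    then show ?thesis using y'[of i] that by (auto simp: y'_def split: if_splits)
  qed
  have odd_out: "2 * i - 1 \<notin> ?J" if "i \<in> {1..s}" for i
    using that by (auto, presburger)
  have two_out: "2 \<notin> ?J" and top_out: "2 * s + 1 \<notin> ?J" using J3 by fastforce+
  have sing: "F t = 0" if t: "t \<in> T" for t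
  proof -
    have "y (2 * i - 1) t = 0" if "i \<in> {1..s}" for i
      using that s_less by (intro coT[OF t _ odd_out]) auto
    moreover have "y (2 * s + 1) t = 0"
      using s_less by (intro coT[OF t _ top_out]) auto
    ultimately show ?thesis by (simp add: F_def)
  qed
  \<comment> \<open>An index of \<open>J\<close> outside the core is the odd member of a later pair.
    Then \<open>chain\<close> puts the whole core into \<open>J\<close>, so the even partner gives a
    unit vector in \<open>T\<close>, and orthogonality to it kills the odd coordinate.\<close>
  have E_eq: "E = Y.coordinate_subspace ({1, 2} \<union> ?J)"
  proof (intro equalityI subsetI)
    fix w assume w: "w \<in> E"
    have "y' i w = 0" if i: "i \<in> {1..m} - ({1, 2} \<union> ?J)" for i
    proof (cases "i \<in> J")
      case False
      then show ?thesis using w i by (auto simp: E_def W_def Y.coordinate_subspace_def)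
    next
      case True
      then have "i \<notin> core_indices" using i by auto
      then have "i < 2 * s + 2" using i by auto
      have "odd i"
      proof
        assume "even i"
        then obtain j where "i = 2 * j" by blast
        then have "i \<in> core_indices" using \<open>i < 2 * s + 2\<close> J3[OF True] by auto
        then show False using \<open>i \<notin> core_indices\<close> by contradiction
      qed
      then obtain k where "i = 2 * k + 1" by (metis oddE)
      then obtain k where k: "i = 2 * k - 1" "k \<in> {2..s}"
        using J3[OF True] \<open>i < 2 * s + 2\<close> that[of "Suc k"] by auto
      have "core_indices \<subseteq> J" using chain True \<open>i \<notin> core_indices\<close> by blast
      then have kJ: "2 * k \<in> ?J" using k by auto
      obtain t where t: "\<forall>j\<in>{1..m}. y' j t = (if j = 2 * k then 1 else 0)"
        using Y.coordinates_exist[of "\<lambda>j. if j = 2 * k then 1 else 0"] by (rule exE)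
      have "t \<in> T" using t kJ by (auto simp: T_def Y.coordinate_subspace_def)
      then have "B t w = 0" using w by (auto simp: E_def)
      moreover have "B t w = y (2 * k - 1) w"
      proof (rule B_unit_even)
        fix j assume "j \<in> {1..2 * s}"
        then have "j \<in> {1..m}" "j \<noteq> 2 * s + 1" using s_less by auto
        then show "y j t = (if j = 2 * k then 1 else 0)" using t small by metis
      qed (use k in auto)
      ultimately show ?thesis using k J3[OF True] by (simp add: small)
    qed
    then show "w \<in> Y.coordinate_subspace ({1, 2} \<union> ?J)"
      by (simp only: Y.coordinate_subspace_def mem_Collect_eq) blast
  next
    fix w assume "w \<in> Y.coordinate_subspace ({1, 2} \<union> ?J)"
    then have y': "y' i w = 0" if "i \<in> {1..m} - ({1, 2} \<union> ?J)" for i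
      using that unfolding Y.coordinate_subspace_def by blast
    then have "w \<in> W" by (auto simp: W_def Y.coordinate_subspace_def)
    moreover have "B t w = 0" if t: "t \<in> T" for t
      unfolding B_def
    proof (rule sum.neutral, rule ballI)
      fix i assume i: "i \<in> {1..s}"
      then have "2 * i - 1 \<in> {1..m}" "2 * i \<in> {1..m}" using s_less by auto
      then have t1: "y (2 * i - 1) t = 0" by (intro coT[OF t _ odd_out[OF i]])
      show "y (2 * i - 1) t * y (2 * i) w + y (2 * i) t * y (2 * i - 1) w = 0"
      proof (cases "i = 1")
        case True
        have "y 2 t = 0" using s_less by (intro coT[OF t _ two_out]) auto
        then show ?thesis using t1 True by simp
      next
        case False
        have "2 * i - 1 \<noteq> 2 * s + 1" "2 * i - 1 \<notin> {1, 2}" using i False by auto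
        then have "y (2 * i - 1) w = 0"
          using y'[of "2 * i - 1"] small odd_out[OF i] \<open>2 * i - 1 \<in> {1..m}\<close> by auto
        then show ?thesis using t1 by simp
      qed
    qed
    ultimately show "w \<in> E" by (simp add: E_def)
  qed
  have "card E = CARD('k) ^ (card ?J + 2)"
    unfolding E_eq Y.card_coordinate_subspace[OF sub(3)] by (subst card_ins) simp_all
  then have card_E: "card E = (CARD('k))\<^sup>2 * card T" by (simp add: card_T power_add power2_eq_square)
  have aniso: "x \<in> T" if x: "x \<in> E" and "F x = 0" for x
  proof -
    have y': "y' i x = 0" if "i \<in> {1..m} - ({1, 2} \<union> ?J)" for i
      using x that unfolding E_eq Y.coordinate_subspace_def by blast
    have "y' (2 * s + 1) x = 0" using s_pos s_less top_out by (intro y') auto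
    then have "y (2 * s + 1) x + (l * y 1 x + y 2 x) = 0" by (simp add: y'_def)
    then have "y (2 * s + 1) x = - (l * y 1 x + y 2 x)" by (simp only: eq_neg_iff_add_eq_0)
    then have top: "y (2 * s + 1) x = l * y 1 x + y 2 x" by (simp only: uminus_id)
    have "(\<Sum>i=1..s. y (2 * i - 1) x * y (2 * i) x) = (\<Sum>i=1..s. if i = 1 then y 1 x * y 2 x else 0)"
    proof (rule sum.cong[OF refl])
      fix i assume i: "i \<in> {1..s}"
      show "y (2 * i - 1) x * y (2 * i) x = (if i = 1 then y 1 x * y 2 x else 0)"
      proof (cases "i = 1")
        case False
        have "2 * i - 1 \<noteq> 2 * s + 1" "2 * i - 1 \<in> {1..m} - ({1, 2} \<union> ?J)"
          using i False odd_out[OF i] s_less by auto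
        then have "y (2 * i - 1) x = 0" using y' small by metis
        then show ?thesis using False by simp
      qed simp
    qed
    also have "\<dots> = y 1 x * y 2 x" using s_pos by simp
    finally have "F x = y 1 x * y 2 x + (l * y 1 x + y 2 x)\<^sup>2" by (simp only: F_def top)
    also have "(l * y 1 x + y 2 x)\<^sup>2 = c * (y 1 x)\<^sup>2 + (y 2 x)\<^sup>2"
      using char2[unfolded one_add_one] by (simp add: power2_sum power_mult_distrib l)
    finally have eq: "y 1 x * y 2 x + (c * (y 1 x)\<^sup>2 + (y 2 x)\<^sup>2) = 0" using \<open>F x = 0\<close> by simp
    have "y 1 x = 0"
    proof (rule ccontr)
      assume "y 1 x \<noteq> 0"
      \<comment> \<open>With \<open>t = y 2 x / y 1 x\<close>, dividing by the square of
        \<open>y 1 x\<close> would give \<open>c = t\<^sup>2 + t\<close>, against the choice of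
        \<open>c\<close>.\<close>
      then have "c + ((y 2 x / y 1 x)\<^sup>2 + y 2 x / y 1 x)
          = (y 1 x * y 2 x + (c * (y 1 x)\<^sup>2 + (y 2 x)\<^sup>2)) / (y 1 x)\<^sup>2"
        by (simp add: field_simps power2_eq_square)
      then have "c = - ((y 2 x / y 1 x)\<^sup>2 + y 2 x / y 1 x)"
        using eq by (simp only: eq_neg_iff_add_eq_0) simp
      then show False using c by (simp only: uminus_id)
    qed
    moreover from this eq have "y 2 x = 0" by simp
    ultimately have "y' 1 x = 0" "y' 2 x = 0" using s_pos s_less by (simp_all add: small)
    then have "y' i x = 0" if "i \<in> {1..m} - ?J" for i
      using that y'[of i] by (cases "i \<in> {1, 2}") auto
    then show ?thesis by (simp only: T_def Y.coordinate_subspace_def mem_Collect_eq) blast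
  qed
  have "CARD('k) * card {x\<in>W. F x = a} = card W + CARD('k) * card T"
    using card_value_by_singular_subspace[OF W T \<open>T \<subseteq> W\<close> a] sing card_E aniso unfolding E_def by blast
  then show ?thesis using W card_W card_T by metis
qed

text \<open>As \<open>r \<le> s\<close>, the core has at most \<open>m - r - 2\<close> elements, so
  \<open>J\<close> can be chosen to contain all of it; the singular part then has its full size,
  independent of \<open>r\<close>.\<close>

lemma ex_subspace_attaining_large:
  assumes "1 \<le> r" "r \<le> s" and a: "a \<noteq> 0"
  shows "\<exists>W. subspace W \<and> card W = CARD('k) ^ (m - r) \<and>
    card {x\<in>W. F x = a} = CARD('k) ^ (m - r - 1) + CARD('k) ^ (m - s - 2)"
proof -
  have "card ({3..m} - {2 * s + 1}) = m - 3" using s_pos s_less by (subst card_Diff_singleton) auto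
  then have "card core_indices \<le> m - r - 2" "m - r - 2 \<le> card ({3..m} - {2 * s + 1})"
    unfolding card_core_indices using assms(1,2) by simp_all
  then obtain J where J: "core_indices \<subseteq> J" "J \<subseteq> {3..m} - {2 * s + 1}" "card J = m - r - 2"
    using exists_subset_between[OF _ _ core_indices_subset] by (metis finite_Diff finite_atLeastAtMost)
  then have int: "J \<inter> core_indices = core_indices" by blast
  obtain W where W: "subspace W" "card W = CARD('k) ^ (m - r - 2 + 2)"
    "CARD('k) * card {x\<in>W. F x = a} = card W + CARD('k) * CARD('k) ^ (m - s - 2)"
    using ex_subspace_many_values[OF J(2) disjI1[OF J(1)] a] unfolding int J(3) card_core_indices
    by blast
  have "m - r - 2 + 2 = Suc (m - r - 1)" "m - r = Suc (m - r - 1)" using assms s_less by auto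
  then have c: "card W = CARD('k) * CARD('k) ^ (m - r - 1)" "card W = CARD('k) ^ (m - r)"
    using W(2) by simp_all
  then have "CARD('k) * card {x\<in>W. F x = a} = CARD('k) * (CARD('k) ^ (m - r - 1) + CARD('k) ^ (m - s - 2))"
    using W(3) by (simp add: distrib_left)
  then show ?thesis using W(1) c(2) by (intro exI[of _ W]) simp
qed

text \<open>Here the core is large enough to contain \<open>J\<close>, so the singular part has
  codimension 2 in \<open>W\<close>.\<close>

lemma ex_subspace_attaining_small:
  assumes "s + 1 \<le> r" "r < m - 1" and a: "a \<noteq> 0"
  shows "\<exists>W. subspace W \<and> card W = CARD('k) ^ (m - r) \<and>
    card {x\<in>W. F x = a} = CARD('k) ^ (m - r - 1) + CARD('k) ^ (m - r - 2)"
proof -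
  have "m - r - 2 \<le> card core_indices" using assms s_less unfolding card_core_indices by simp
  then obtain J where J: "J \<subseteq> core_indices" "card J = m - r - 2"
    by (meson obtain_subset_with_card_n)
  then have int: "J \<inter> core_indices = J" by blast
  have sub: "J \<subseteq> {3..m} - {2 * s + 1}" using J(1) core_indices_subset by blast
  obtain W where W: "subspace W" "card W = CARD('k) ^ (m - r - 2 + 2)"
    "CARD('k) * card {x\<in>W. F x = a} = card W + CARD('k) * CARD('k) ^ (m - r - 2)"
    using ex_subspace_many_values[OF sub disjI2[OF J(1)] a] unfolding int J(2) by blast
  have "m - r - 2 + 2 = Suc (m - r - 1)" "m - r = Suc (m - r - 1)" using assms by auto
  then have c: "card W = CARD('k) * CARD('k) ^ (m - r - 1)" "card W = CARD('k) ^ (m - r)"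
    using W(2) by simp_all
  then have "CARD('k) * card {x\<in>W. F x = a} = CARD('k) * (CARD('k) ^ (m - r - 1) + CARD('k) ^ (m - r - 2))"
    using W(3) by (simp add: distrib_left)
  then show ?thesis using W(1) c(2) by (intro exI[of _ W]) simp
qed

section \<open>Size of the level set and bounds by codimension\<close>

text \<open>The non-singular radical vector rules out the second case of
  \<open>card_value_dichotomy\<close> for the whole space.\<close>

lemma card_level_set:
  assumes a: "a \<noteq> 0"
  shows "card {x. F x = a} = CARD('k) ^ (m - 1)"
proof -
  obtain u where "F u = 1" "\<forall>x. B u x = 0" using ex_nonsingular_radical by blast
  then have "CARD('k) * card {x\<in>UNIV. F x = a} = CARD('v)"
    using card_value_dichotomy[OF subspace_UNIV a] by (auto simp: B_sym)
  also have "CARD('v) = CARD('k) * CARD('k) ^ (m - 1)"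
    using s_less by (simp add: card_space power_Suc[symmetric] del: power_Suc)
  finally show ?thesis by simp
qed

text \<open>Otherwise \<open>card_value_le_large\<close> would give
  \<open>q ^ m \<le> q ^ (m - 1) + q ^ (m - s - 1)\<close>, which fails as \<open>s\<close> is
  positive. This is what makes the code have dimension \<open>m\<close>.\<close>

lemma level_set_not_in_hyperplane:
  assumes a: "a \<noteq> 0" and W: "subspace W" and card_W: "CARD('k) * card W = CARD('k) ^ m"
  shows "\<exists>x. F x = a \<and> x \<notin> W"
proof (rule ccontr)
  define q where "q = CARD('k)"
  have q: "2 \<le> q" using CARD_field_gt_1[where 'k = 'k] by (simp add: q_def)
  have "q * card W = q * q ^ (m - 1)"
    using card_W s_less by (simp add: q_def power_Suc[symmetric] del: power_Suc)
  then have card_W': "card W = q ^ (m - 1)" using q by simp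
  assume "\<not> ?thesis"
  then have "{x\<in>W. F x = a} = {x. F x = a}" by blast
  then have "q * q ^ (m - 1) \<le> q ^ (m - 1) + q ^ (m - s - 1)"
    using card_value_le_large[OF W a] card_level_set[OF a] card_W' by (simp add: q_def)
  also have "q ^ (m - s - 1) \<le> q ^ (m - 2)" using q s_pos by (intro power_increasing) auto
  also have "q ^ (m - 2) < q ^ (m - 1)" using q s_less by (intro power_strict_increasing) auto
  also have "q ^ (m - 1) + q ^ (m - 1) = 2 * q ^ (m - 1)" by simp
  also have "\<dots> \<le> q * q ^ (m - 1)" using q by simp
  finally show False by simp
qed

lemma card_value_le_max_large:
  assumes W: "subspace W" and a: "a \<noteq> 0" and "card W = CARD('k) ^ (m - r)" and r: "r \<le> s"
  shows "card {x\<in>W. F x = a} \<le> CARD('k) ^ (m - r - 1) + CARD('k) ^ (m - s - 2)"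
proof -
  have e: "m - r = Suc (m - r - 1)" "m - s - 1 = Suc (m - s - 2)" using r s_pos s_less by auto
  have "CARD('k) ^ (m - r) = CARD('k) * CARD('k) ^ (m - r - 1)"
    "CARD('k) ^ (m - s - 1) = CARD('k) * CARD('k) ^ (m - s - 2)"
    by (subst e, rule power_Suc)+
  then have "CARD('k) * card {x\<in>W. F x = a}
      \<le> CARD('k) * (CARD('k) ^ (m - r - 1) + CARD('k) ^ (m - s - 2))"
    using card_value_le_large[OF W a] assms(3) by (simp add: distrib_left)
  then show ?thesis by simp
qed

lemma card_value_le_max_small:
  assumes W: "subspace W" and a: "a \<noteq> 0" and "card W = CARD('k) ^ (m - r)" and r: "r < m - 1"
  shows "card {x\<in>W. F x = a} \<le> CARD('k) ^ (m - r - 1) + CARD('k) ^ (m - r - 2)"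
proof -
  have e: "m - r = Suc (Suc (m - r - 2))" "m - r - 1 = Suc (m - r - 2)" using r by auto
  have p: "CARD('k) ^ (m - r) = (CARD('k))\<^sup>2 * CARD('k) ^ (m - r - 2)"
    "CARD('k) ^ (m - r - 1) = CARD('k) * CARD('k) ^ (m - r - 2)"
    by (subst e, simp add: power2_eq_square)+
  have "(CARD('k))\<^sup>2 * card {x\<in>W. F x = a} \<le> (CARD('k) + 1) * card W"
    by (rule card_value_le_small[OF W a])
  also have "\<dots> = (CARD('k))\<^sup>2 * (CARD('k) ^ (m - r - 1) + CARD('k) ^ (m - r - 2))"
    unfolding assms(3) p by (simp add: algebra_simps)
  finally show ?thesis by simp
qed

lemma card_value_line_le:
  assumes W: "subspace W" and a: "a \<noteq> 0" and "card W = CARD('k)"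
  shows "card {x\<in>W. F x = a} \<le> 1"
proof (rule ccontr)
  define q where "q = CARD('k)"
  have q: "2 \<le> q" using CARD_field_gt_1[where 'k = 'k] by (simp add: q_def)
  assume "\<not> ?thesis"
  then have "q\<^sup>2 * 2 \<le> q\<^sup>2 * card {x\<in>W. F x = a}" by simp
  also have "\<dots> \<le> (q + 1) * q" using card_value_le_small[OF W a] assms(3) by (simp add: q_def)
  finally have "q * q \<le> 1 * q" by (simp add: power2_eq_square)
  then show False using q by simp
qed

lemma ex_line_meeting_level_set:
  assumes a: "a \<noteq> 0"
  shows "\<exists>W. subspace W \<and> card W = CARD('k) \<and> card {x\<in>W. F x = a} = 1"
proof -
  have "{x. F x = a} \<noteq> {}" using card_level_set[OF a] by (auto simp del: Collect_empty_eq)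
  then obtain d where d: "F d = a" by blast
  then have "independent {d}" using a f_zero by auto
  then have card: "card (span {d}) = CARD('k)" using card_span_independent[of "{d}"] by simp
  have "d \<in> {x\<in>span {d}. F x = a}" using d by (simp add: span_base)
  then have "card {x\<in>span {d}. F x = a} \<noteq> 0" by (metis card_0_eq empty_iff finite)
  then have "card {x\<in>span {d}. F x = a} = 1"
    using card_value_line_le[OF subspace_span a card] by linarith
  then show ?thesis using card subspace_span by blast
qed

end

section \<open>Weights and orthogonal spaces\<close>

text \<open>The trace code in abstract form: \<open>separating\<close> makes the encoding injective,
  so subcodes are images of subspaces, and \<open>nondegenerate\<close> makes orthogonality a
  duality between dimension and codimension.\<close>

locale evaluation_code = finite_vector_space scale
  for scale :: "'k::{field,finite} \<Rightarrow> 'v::{ab_group_add,finite} \<Rightarrow> 'v" (infixr \<open>*s\<close> 75) +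
  fixes \<beta> :: "'v \<Rightarrow> 'v \<Rightarrow> 'k" and D :: "'v set" and m :: nat
  assumes \<beta>_sym: "\<beta> x z = \<beta> z x"
    and \<beta>_add: "\<beta> (x + z) w = \<beta> x w + \<beta> z w"
    and \<beta>_scale: "\<beta> (c *s x) w = c * \<beta> x w"
    and nondegenerate: "(\<And>x. \<beta> x w = 0) \<Longrightarrow> w = 0"
    and card_space: "CARD('v) = CARD('k) ^ m"
    and separating: "(\<And>d. d \<in> D \<Longrightarrow> \<beta> x d = 0) \<Longrightarrow> x = 0"
begin

lemma \<beta>_add_right: "\<beta> w (x + z) = \<beta> w x + \<beta> w z"
  using \<beta>_add \<beta>_sym by simp

lemma \<beta>_scale_right: "\<beta> w (c *s x) = c * \<beta> w x"
  using \<beta>_scale \<beta>_sym by simp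

lemma \<beta>_zero: "\<beta> 0 w = 0" "\<beta> w 0 = 0"
  using \<beta>_scale[of 0 0 w] \<beta>_scale_right[of w 0 0] by simp_all

definition word :: "'v \<Rightarrow> 'v \<Rightarrow> 'k" where
  "word x = (\<lambda>d. if d \<in> D then \<beta> x d else 0)"

definition perp :: "'v set \<Rightarrow> 'v set" where
  "perp X = {d. \<forall>x\<in>X. \<beta> d x = 0}"

sublocale words: finite_vector_space "word_scale :: 'k \<Rightarrow> ('v \<Rightarrow> 'k) \<Rightarrow> 'v \<Rightarrow> 'k"
  by (rule finite_vector_space.intro[OF vector_space_word_scale])

lemma word_add: "word (x + z) = word x + word z"
  by (auto simp: word_def \<beta>_add)

lemma word_scale: "word (c *s x) = word_scale c (word x)"
  by (auto simp: word_def \<beta>_scale word_scale_def)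

lemma word_zero: "word 0 = 0"
  by (auto simp: word_def \<beta>_zero)

lemma inj_word: "inj word"
proof (rule injI)
  fix x z assume "word x = word z"
  then have *: "\<beta> x d = \<beta> z d" if "d \<in> D" for d
    using that by (metis word_def)
  have "x - z = 0"
  proof (rule separating)
    fix d assume "d \<in> D"
    then show "\<beta> (x - z) d = 0" using *[of d] \<beta>_add[of "x - z" z d] by simp
  qed
  then show "x = z" by simp
qed

lemma subspace_word_image:
  assumes "subspace X"
  shows "words.subspace (word ` X)"
  unfolding words.subspace_def
proof (intro conjI ballI allI)
  show "0 \<in> word ` X" using word_zero subspace_0[OF assms] by (metis image_eqI)
next
  fix u v assume "u \<in> word ` X" "v \<in> word ` X"
  then obtain x z where "u = word x" "v = word z" "x \<in> X" "z \<in> X" by blast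
  then show "u + v \<in> word ` X"
    using subspace_add[OF assms] by (simp add: word_add[symmetric])
next
  fix c u assume "u \<in> word ` X"
  then obtain x where "u = word x" "x \<in> X" by blast
  then show "word_scale c u \<in> word ` X"
    using subspace_scale[OF assms] by (simp add: word_scale[symmetric])
qed

lemma subspace_word_vimage:
  assumes "words.subspace H"
  shows "subspace (word -` H)"
  using assms by (simp add: subspace_def words.subspace_def word_zero word_add word_scale)

lemma card_word_image: "card (word ` X) = card X"
  by (rule card_image[OF inj_on_subset[OF inj_word subset_UNIV]])

lemma subspace_range_word: "words.subspace (range word)"
  by (rule subspace_word_image[OF subspace_UNIV])

lemma dim_range_word: "words.dim (range word) = m"
  by (simp add: words.dim_eq_iff_card[OF subspace_range_word] card_word_image card_space)

text \<open>A position \<open>d\<close> is missed by every word of the subcode exactly when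
  \<open>d\<close> is orthogonal to \<open>X\<close>.\<close>

lemma card_code_supp_word_image: "card (code_supp (word ` X)) = card D - card (D \<inter> perp X)"
proof -
  have "code_supp (word ` X) = D - (D \<inter> perp X)"
    by (auto simp: code_supp_def word_def perp_def \<beta>_sym split: if_splits)
  then show ?thesis by (simp add: card_Diff_subset)
qed

lemma subspace_perp: "subspace (perp X)"
  by (auto simp: subspace_def perp_def \<beta>_add \<beta>_scale \<beta>_zero)

lemma card_perp:
  assumes X: "subspace X" and "card X = CARD('k) ^ r" and "r \<le> m"
  shows "card (perp X) = CARD('k) ^ (m - r)"
proof -
  have "card (perp X) * card X = CARD('v) * card {w\<in>X. \<forall>x. \<beta> x w = 0}"
    unfolding perp_def
    by (rule card_orthogonal[OF X]) (simp_all add: \<beta>_add \<beta>_scale \<beta>_add_right \<beta>_scale_right)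
  also have "{w\<in>X. \<forall>x. \<beta> x w = 0} = {0}"
    using nondegenerate subspace_0[OF X] by (auto simp: \<beta>_zero)
  finally have "card (perp X) * CARD('k) ^ r = CARD('k) ^ (m - r) * CARD('k) ^ r"
    using assms by (simp add: card_space power_add[symmetric])
  then show ?thesis by simp
qed

lemma perp_perp:
  assumes X: "subspace X" and "card X = CARD('k) ^ r" and "r \<le> m"
  shows "perp (perp X) = X"
proof (rule card_subset_eq[symmetric])
  show "X \<subseteq> perp (perp X)" by (auto simp: perp_def \<beta>_sym)
  have "card (perp (perp X)) = CARD('k) ^ (m - (m - r))"
    by (rule card_perp[OF subspace_perp card_perp[OF assms]]) simp
  then show "card X = card (perp (perp X))" using assms by simp
qed simp

text \<open>Subcodes of dimension \<open>r\<close> correspond to subspaces \<open>X\<close> of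
  dimension \<open>r\<close>, and through \<open>perp\<close> to subspaces of codimension
  \<open>r\<close>; a smallest support means a largest intersection with \<open>D\<close>.\<close>

lemma gen_hamming_weight_eq:
  assumes r: "r \<le> m"
    and le: "\<And>W. subspace W \<Longrightarrow> card W = CARD('k) ^ (m - r) \<Longrightarrow> card (D \<inter> W) \<le> M"
    and ex: "\<exists>W. subspace W \<and> card W = CARD('k) ^ (m - r) \<and> card (D \<inter> W) = M"
  shows "gen_hamming_weight (range word) r = card D - M"
proof -
  let ?S = "{card (code_supp H) | H. H \<subseteq> range word \<and> words.subspace H \<and> words.dim H = r}"
  show ?thesis unfolding gen_hamming_weight_def
  proof (rule Min_eqI)
    show "finite ?S" by simp
  next
    fix n assume "n \<in> ?S"
    then obtain H where H: "n = card (code_supp H)" "H \<subseteq> range word" "words.subspace H" "words.dim H = r"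
      by blast
    define X where "X = word -` H"
    have X: "subspace X" unfolding X_def by (rule subspace_word_vimage[OF H(3)])
    have HX: "H = word ` X" using H(2) by (auto simp: X_def)
    have "card X = CARD('k) ^ r"
      using words.card_subspace[OF H(3)] H(4) by (simp add: HX card_word_image)
    then have "card (D \<inter> perp X) \<le> M"
      by (intro le subspace_perp card_perp[OF X _ r])
    then show "card D - M \<le> n" unfolding H(1) HX card_code_supp_word_image by simp
  next
    obtain W where W: "subspace W" "card W = CARD('k) ^ (m - r)" "card (D \<inter> W) = M" using ex by blast
    \<comment> \<open>The subcode realising the minimum is the image of
      \<open>perp W\<close>.\<close>
    have pp: "perp (perp W) = W" by (rule perp_perp[OF W(1,2)]) simp
    have "card (perp W) = CARD('k) ^ (m - (m - r))" by (rule card_perp[OF W(1,2)]) simp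
    then have "words.dim (word ` perp W) = r"
      using r by (simp add: words.dim_eq_iff_card subspace_word_image subspace_perp card_word_image)
    then have "card (code_supp (word ` perp W)) \<in> ?S"
      using subspace_word_image[OF subspace_perp] by blast
    then show "card D - M \<in> ?S" unfolding card_code_supp_word_image pp W(3) .
  qed
qed

end

section \<open>The trace form\<close>

text \<open>Multiplication by a non-zero \<open>x\<close> permutes the non-zero elements; compare
  their products.\<close>

lemma finite_field_power_card:
  fixes x :: "'a::{field,finite}"
  shows "x ^ CARD('a) = x"
proof (cases "x = 0")
  case False
  have "bij_betw (\<lambda>y. x * y) (UNIV - {0}) (UNIV - {0})"
    by (rule bij_betw_byWitness[where f' = "\<lambda>y. y / x"]) (use False in auto)
  then have "(\<Prod>y\<in>UNIV - {0}. x * y) = \<Prod>(UNIV - {0})"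
    by (rule prod.reindex_bij_betw)
  then have "x ^ (CARD('a) - 1) * \<Prod>(UNIV - {0 :: 'a}) = \<Prod>(UNIV - {0 :: 'a})"
    by (simp add: prod.distrib)
  then have "x ^ (CARD('a) - 1) = 1" by simp
  moreover have "CARD('a) = Suc (CARD('a) - 1)" using CARD_field_gt_1[where 'k = 'a] by simp
  ultimately show ?thesis by (metis power_Suc mult_1_right)
qed simp

text \<open>The shift by 1 permutes the field; comparing sums shows that the number of elements is
  zero in the field.\<close>

lemma char2_of_card:
  assumes "CARD('a::{field,finite}) = 2 ^ e"
  shows "(1 :: 'a) + 1 = 0"
proof -
  have "(\<Sum>x\<in>(UNIV :: 'a set). x + 1) = \<Sum>UNIV"
    by (rule sum.reindex_bij_betw) (rule bij_betw_byWitness[where f' = "\<lambda>x. x - 1"], auto)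
  then have "(of_nat CARD('a) :: 'a) = 0" by (simp add: sum.distrib)
  then show ?thesis by (simp add: assms one_add_one)
qed

locale finite_char2_extension = field_embedding emb
  for emb :: "'k::{field,finite} \<Rightarrow> 'l::{field,finite}" +
  fixes e m :: nat
  assumes card_base: "CARD('k) = 2 ^ e"
    and card_ext: "CARD('l) = CARD('k) ^ m"
    and degree_pos: "m > 0"
begin

lemma char2_base: "(1 :: 'k) + 1 = 0"
  by (rule char2_of_card[OF card_base])

lemma char2_ext: "(2 :: 'l) = 0"
proof -
  have "CARD('l) = 2 ^ (e * m)" by (simp add: card_ext card_base power_mult)
  then show ?thesis using char2_of_card by (metis one_add_one)
qed

lemma emb_zero: "emb 0 = 0"
proof -
  have "emb 0 + emb 0 = emb 0 + 0"
    using emb_add[of 0 0] by (simp only: add_0_right)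
  then show ?thesis by (rule add_left_imp_eq)
qed

lemma emb_power: "emb (x ^ n) = emb x ^ n"
  by (induction n) (simp_all add: emb_one emb_mult)

lemma inj_emb: "inj emb"
proof (rule injI, rule ccontr)
  fix x y assume eq: "emb x = emb y" and "x \<noteq> y"
  have "emb (x - y) = 0" using emb_add[of "x - y" y] eq by simp
  moreover have "emb (x - y) * emb (1 / (x - y)) = 1"
    using \<open>x \<noteq> y\<close> by (simp add: emb_mult[symmetric] emb_one)
  ultimately show False by simp
qed

lemma frobenius_add: "((x :: 'l) + y) ^ CARD('k) = x ^ CARD('k) + y ^ CARD('k)"
proof -
  have "(x + y) ^ (2 ^ n) = x ^ (2 ^ n) + y ^ (2 ^ n)" for n
  proof (induction n)
    case (Suc n)
    have "(x + y) ^ (2 ^ Suc n) = ((x + y) ^ (2 ^ n))\<^sup>2" by (simp add: power_mult[symmetric] mult.commute)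
    also have "\<dots> = (x ^ (2 ^ n))\<^sup>2 + (y ^ (2 ^ n))\<^sup>2" by (simp add: Suc power2_sum char2_ext)
    finally show ?case by (simp add: power_mult[symmetric] mult.commute)
  qed simp
  then show ?thesis by (simp add: card_base)
qed

lemma frobenius_iterate_add:
  "((x :: 'l) + y) ^ (CARD('k) ^ i) = x ^ (CARD('k) ^ i) + y ^ (CARD('k) ^ i)"
proof (induction i)
  case (Suc i)
  have p: "z ^ (CARD('k) ^ Suc i) = (z ^ (CARD('k) ^ i)) ^ CARD('k)" for z :: 'l
    by (simp add: power_mult[symmetric] mult.commute)
  show ?case unfolding p Suc by (rule frobenius_add)
qed simp

lemma frobenius_sum: "(\<Sum>i\<in>A. g i :: 'l) ^ CARD('k) = (\<Sum>i\<in>A. g i ^ CARD('k))"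
  by (induction A rule: infinite_finite_induct) (simp_all add: frobenius_add)

text \<open>The image of \<open>emb\<close> already supplies as many roots of
  \<open>z ^ CARD('k) - z\<close> as its degree permits.\<close>

lemma range_emb_eq: "range emb = {z. z ^ CARD('k) = z}"
proof (rule card_subset_eq)
  let ?p = "monom 1 CARD('k) - monom 1 1 :: 'l poly"
  have q: "CARD('k) > 1" by (rule CARD_field_gt_1)
  have "coeff ?p CARD('k) = 1" using q by simp
  then have "?p \<noteq> 0" by (metis coeff_0 zero_neq_one)
  have "degree ?p \<le> CARD('k)"
    using q by (intro degree_diff_le) (auto intro: order.trans[OF degree_monom_le])
  have "{z. z ^ CARD('k) = z} = {z. poly ?p z = 0}" by (simp add: poly_monom)
  then have "card {z :: 'l. z ^ CARD('k) = z} \<le> CARD('k)"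
    using card_poly_roots_bound[OF \<open>?p \<noteq> 0\<close>] \<open>degree ?p \<le> CARD('k)\<close> by simp
  moreover show "range emb \<subseteq> {z. z ^ CARD('k) = z}"
    by (auto simp: emb_power[symmetric] finite_field_power_card)
  then have "card (range emb) \<le> card {z :: 'l. z ^ CARD('k) = z}" by (intro card_mono) simp_all
  ultimately show "card (range emb) = card {z :: 'l. z ^ CARD('k) = z}"
    using card_image[OF inj_emb] by simp
qed simp

text \<open>The use of \<open>inv emb\<close> in \<open>trace\<close> is justified because the sum
  of conjugates is fixed by the Frobenius map: raising to the power \<open>CARD('k)\<close> shifts
  the summands cyclically.\<close>

lemma emb_trace: "emb (trace emb m x) = (\<Sum>i<m. x ^ (CARD('k) ^ i))"
proof -
  let ?z = "\<Sum>i<m. x ^ (CARD('k) ^ i)"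
  have "?z ^ CARD('k) = (\<Sum>i<m. x ^ (CARD('k) ^ Suc i))"
    unfolding frobenius_sum by (simp add: power_mult[symmetric] mult.commute)
  also have "\<dots> = ?z"
  proof -
    have "(\<Sum>i<m. x ^ (CARD('k) ^ Suc i)) + x ^ (CARD('k) ^ 0) = ?z + x ^ (CARD('k) ^ m)"
      using sum.lessThan_Suc_shift[of "\<lambda>i. x ^ (CARD('k) ^ i)" m]
        sum.lessThan_Suc[of "\<lambda>i. x ^ (CARD('k) ^ i)" m] by (simp add: add.commute)
    moreover have "x ^ (CARD('k) ^ m) = x"
      using finite_field_power_card[of x] by (simp add: card_ext)
    ultimately show ?thesis by simp
  qed
  finally have "?z \<in> range emb" by (simp add: range_emb_eq)
  then show ?thesis unfolding trace_def by (rule f_inv_into_f)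
qed

lemma trace_add: "trace emb m (x + y) = trace emb m x + trace emb m y"
proof -
  have "emb (trace emb m (x + y)) = emb (trace emb m x + trace emb m y)"
    by (simp add: emb_trace emb_add frobenius_iterate_add sum.distrib)
  then show ?thesis by (rule injD[OF inj_emb])
qed

lemma trace_scale: "trace emb m (emb c * x) = c * trace emb m x"
proof -
  have c: "c ^ (CARD('k) ^ i) = c" for i
    by (induction i) (simp_all add: power_mult finite_field_power_card)
  have "emb (trace emb m (emb c * x)) = emb (c * trace emb m x)"
    by (simp add: emb_trace emb_mult power_mult_distrib sum_distrib_left emb_power[symmetric] c)
  then show ?thesis by (rule injD[OF inj_emb])
qed

text \<open>The trace polynomial has degree at most \<open>CARD('k) ^ (m - 1)\<close>, too small to
  vanish on the whole extension field.\<close>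

lemma trace_not_zero: "\<exists>x. trace emb m x \<noteq> 0"
proof (rule ccontr)
  assume "\<not> ?thesis"
  then have zero: "(\<Sum>i<m. x ^ (CARD('k) ^ i)) = 0" for x :: 'l
    using emb_trace[of x] emb_zero by simp
  have q: "CARD('k) > 1" by (rule CARD_field_gt_1)
  let ?p = "\<Sum>i<m. monom 1 (CARD('k) ^ i) :: 'l poly"
  \<comment> \<open>Only the summand \<open>i = 0\<close> has degree 1, so the polynomial is not
    zero.\<close>
  have "coeff ?p 1 = (\<Sum>i<m. if i = 0 then 1 else 0)"
    unfolding coeff_sum using q by (intro sum.cong) auto
  also have "\<dots> = 1" using degree_pos by simp
  finally have "?p \<noteq> 0" by (metis coeff_0 zero_neq_one)
  have "degree ?p \<le> CARD('k) ^ (m - 1)"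
  proof (rule degree_sum_le)
    fix i assume "i \<in> {..<m}"
    then have "CARD('k) ^ i \<le> CARD('k) ^ (m - 1)" using q by (intro power_increasing) auto
    then show "degree (monom 1 (CARD('k) ^ i) :: 'l poly) \<le> CARD('k) ^ (m - 1)"
      by (simp add: degree_monom_eq)
  qed simp
  moreover have "{x. poly ?p x = 0} = UNIV" using zero by (simp add: poly_sum poly_monom)
  then have "CARD('l) \<le> degree ?p" using card_poly_roots_bound[OF \<open>?p \<noteq> 0\<close>] by simp
  ultimately have "CARD('k) ^ m \<le> CARD('k) ^ (m - 1)" by (simp add: card_ext)
  moreover have "CARD('k) ^ (m - 1) < CARD('k) ^ m"
    using q degree_pos by (intro power_strict_increasing) auto
  ultimately show False by simp
qed

lemma trace_nondegenerate:
  assumes "\<And>x. trace emb m (x * w) = 0"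
  shows "w = 0"
proof (rule ccontr)
  assume "w \<noteq> 0"
  obtain x where "trace emb m x \<noteq> 0" using trace_not_zero by blast
  then show False using assms[of "x / w"] \<open>w \<noteq> 0\<close> by simp
qed

end

section \<open>The weight hierarchy\<close>

lemma (in field_embedding) coord_linear:
  assumes "is_basis emb m \<epsilon>"
  shows "coord emb m \<epsilon> (x + z) i = coord emb m \<epsilon> x i + coord emb m \<epsilon> z i"
    and "coord emb m \<epsilon> (ext_scale emb c x) i = c * coord emb m \<epsilon> x i"
    and "(\<And>i. i \<in> {1..m} \<Longrightarrow> coord emb m \<epsilon> x i = 0) \<Longrightarrow> x = 0"
proof -
  interpret vector_space "ext_scale emb" by (rule vector_space_ext_scale)
  have ind: "independent (\<epsilon> ` {1..m})" and span: "span (\<epsilon> ` {1..m}) = UNIV"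
    using assms by (simp_all add: is_basis_def)
  show "coord emb m \<epsilon> (x + z) i = coord emb m \<epsilon> x i + coord emb m \<epsilon> z i"
    "coord emb m \<epsilon> (ext_scale emb c x) i = c * coord emb m \<epsilon> x i"
    unfolding coord_def using ind span by (simp_all add: representation_add representation_scale)
  assume "\<And>i. i \<in> {1..m} \<Longrightarrow> coord emb m \<epsilon> x i = 0"
  then have "(\<Sum>b\<in>\<epsilon> ` {1..m}. ext_scale emb (representation (\<epsilon> ` {1..m}) x b) b) = 0"
    unfolding coord_def by (intro sum.neutral) auto
  moreover have "(\<Sum>b\<in>\<epsilon> ` {1..m}. ext_scale emb (representation (\<epsilon> ` {1..m}) x b) b) = x"
    using ind span by (intro sum_representation_eq) auto
  ultimately show "x = 0" by simp
qed

theorem theorem6: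
  fixes emb :: "'k::{field,finite} \<Rightarrow> 'l::{field,finite}"
    and q e m s :: nat
    and \<epsilon> :: "nat \<Rightarrow> 'l"
    and f :: "'l \<Rightarrow> 'k"
    and a :: 'k
    and D :: "'l set"
    and C :: "('l \<Rightarrow> 'k) set"
  assumes "field_embedding emb"
    and "q = 2 ^ e" and "m > 0"
    and "CARD('k) = q" and "CARD('l) = q ^ m"
    and "is_basis emb m \<epsilon>"
    and "a \<noteq> 0"
    and "quadratic_form emb m \<epsilon> f"
    and "\<not> nondegenerate f"
    and "qf_rank emb m f = 2 * s + 1"
    and "s \<ge> 1" and "2 * s + 1 < m"
    and "qf_equivalent emb f (type_III emb m \<epsilon> (2 * s + 1))"
  defines "D \<equiv> {x. f x = a}"
    and "C \<equiv> trace_code emb m D"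
  shows "module.subspace word_scale C \<and> vector_space.dim word_scale C = m \<and>
    (\<forall>r. 1 \<le> r \<and> r \<le> m \<longrightarrow>
      (1 \<le> r \<and> r \<le> s \<longrightarrow>
        int (gen_hamming_weight C r) = int q ^ (m - 1) - int q ^ (m - r - 1) - int q ^ (m - s - 2)) \<and>
      (s + 1 \<le> r \<and> r < m - 1 \<longrightarrow>
        int (gen_hamming_weight C r) = int q ^ (m - 1) - int q ^ (m - r - 1) - int q ^ (m - r - 2)) \<and>
      (r = m - 1 \<longrightarrow> int (gen_hamming_weight C r) = int q ^ (m - 1) - 1) \<and>
      (r = m \<longrightarrow> int (gen_hamming_weight C r) = int q ^ (m - 1)))"
proof -
  interpret ext: finite_char2_extension emb e m
    using assms(1-5) by (simp add: finite_char2_extension_def finite_char2_extension_axioms_def)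
  interpret V: finite_vector_space "ext_scale emb"
    by (rule finite_vector_space.intro[OF ext.vector_space_ext_scale])
  obtain T where T: "Vector_Spaces.linear (ext_scale emb) (ext_scale emb) T" "bij T"
    and fT: "\<And>x. f x = type_III emb m \<epsilon> (2 * s + 1) (T x)"
    using assms(13) unfolding qf_equivalent_def by blast
  interpret T: Vector_Spaces.linear "ext_scale emb" "ext_scale emb" T by (rule T(1))
  \<comment> \<open>Absorbing the equivalence \<open>T\<close> into the coordinates turns
    \<open>f\<close> itself into the normal form and leaves the trace pairing untouched.\<close>
  define y where "y i x = coord emb m \<epsilon> (T x) i" for i x
  interpret Q: type_III_space "ext_scale emb" y m s
  proof
    fix i x z c
    show "y i (x + z) = y i x + y i z" "y i (ext_scale emb c x) = c * y i x"
      by (simp_all add: y_def T.add T.scale ext.coord_linear(1,2)[OF assms(6)])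
  next
    fix x assume "\<And>i. i \<in> {1..m} \<Longrightarrow> y i x = 0"
    then have "T x = T 0"
      unfolding y_def by (simp only: T.zero) (rule ext.coord_linear(3)[OF assms(6)])
    then show "x = 0" by (rule injD[OF bij_is_inj[OF T(2)]])
  qed (use assms(11,12) ext.card_ext ext.char2_base in simp_all)
  have D_eq: "D = {x. Q.F x = a}"
    unfolding D_def fT by (simp add: type_III_def Q.F_def y_def)
  have a: "a \<noteq> 0" by (rule assms(7))
  let ?\<beta> = "\<lambda>x d. trace emb m (x * d)"
  interpret code: evaluation_code "ext_scale emb" ?\<beta> D m
  proof
    fix x z w c
    show "?\<beta> x z = ?\<beta> z x" by (simp add: mult.commute)
    show "?\<beta> (x + z) w = ?\<beta> x w + ?\<beta> z w" by (simp add: distrib_right ext.trace_add)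
    show "?\<beta> (ext_scale emb c x) w = c * ?\<beta> x w"
      by (simp add: ext_scale_def mult.assoc ext.trace_scale)
  next
    fix w assume "\<And>x. ?\<beta> x w = 0"
    then show "w = 0" by (rule ext.trace_nondegenerate)
  next
    fix x assume zero: "\<And>d. d \<in> D \<Longrightarrow> ?\<beta> x d = 0"
    \<comment> \<open>For \<open>x \<noteq> 0\<close> the zeros of the functional form a hyperplane,
      which cannot contain the level set \<open>D\<close>.\<close>
    show "x = 0"
    proof (rule ccontr)
      assume "x \<noteq> 0"
      have add: "?\<beta> x (d + d') = ?\<beta> x d + ?\<beta> x d'" for d d'
        by (simp add: distrib_left ext.trace_add)
      have scale: "?\<beta> x (ext_scale emb c d) = c * ?\<beta> x d" for c d
        by (simp add: ext_scale_def mult.left_commute[of x] ext.trace_scale)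
      obtain z where "?\<beta> x z \<noteq> 0"
        using ext.trace_nondegenerate[of x] \<open>x \<noteq> 0\<close> by (auto simp: mult.commute)
      then have "CARD('k) * card {d\<in>UNIV. ?\<beta> x d = 0} = CARD('k) ^ m"
        unfolding ext.card_ext[symmetric]
        by (intro V.card_fibre_linear V.subspace_UNIV add scale) simp_all
      moreover have "V.subspace {d. ?\<beta> x d = 0}"
        unfolding V.subspace_def using ext.trace_scale[of 0 0] by (simp add: add scale)
      ultimately show False
        using Q.level_set_not_in_hyperplane[OF a, of "{d. ?\<beta> x d = 0}"] zero D_eq by auto
    qed
  qed (rule ext.card_ext)
  have C_eq: "C = range code.word"
    unfolding C_def trace_code_def by (auto simp: code.word_def fun_eq_iff)
  have D_Int: "D \<inter> W = {x\<in>W. Q.F x = a}" for W by (auto simp: D_eq)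
  have weight: "int (gen_hamming_weight C r) = int q ^ (m - 1) - int M"
    if "r \<le> m"
      and le: "\<And>W. V.subspace W \<Longrightarrow> card W = CARD('k) ^ (m - r) \<Longrightarrow> card {x\<in>W. Q.F x = a} \<le> M"
      and ex: "\<exists>W. V.subspace W \<and> card W = CARD('k) ^ (m - r) \<and> card {x\<in>W. Q.F x = a} = M" for r M
  proof -
    have "gen_hamming_weight C r = card D - M"
      unfolding C_eq by (rule code.gen_hamming_weight_eq) (use that in \<open>simp_all only: D_Int\<close>)
    \<comment> \<open>This keeps the subtraction of natural numbers \<open>card D - M\<close> from
      being truncated.\<close>
    moreover have "M \<le> card D" using ex D_Int by (metis Int_lower1 card_mono finite)
    moreover have "card D = q ^ (m - 1)"
      unfolding D_eq using Q.card_level_set[OF a] assms(4) by simp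
    ultimately show ?thesis by (simp add: of_nat_diff)
  qed
  have large: "int (gen_hamming_weight C r) = int q ^ (m - 1) - int q ^ (m - r - 1) - int q ^ (m - s - 2)"
    if "1 \<le> r" "r \<le> s" for r
  proof -
    have "int (gen_hamming_weight C r) = int q ^ (m - 1) - int (CARD('k) ^ (m - r - 1) + CARD('k) ^ (m - s - 2))"
      using that assms(12)
      by (intro weight Q.card_value_le_max_large Q.ex_subspace_attaining_large a) simp_all
    then show ?thesis by (simp add: assms(4))
  qed
  have small: "int (gen_hamming_weight C r) = int q ^ (m - 1) - int q ^ (m - r - 1) - int q ^ (m - r - 2)"
    if "s + 1 \<le> r" "r < m - 1" for r
  proof -
    have "int (gen_hamming_weight C r) = int q ^ (m - 1) - int (CARD('k) ^ (m - r - 1) + CARD('k) ^ (m - r - 2))"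
      using that
      by (intro weight Q.card_value_le_max_small Q.ex_subspace_attaining_small a) simp_all
    then show ?thesis by (simp add: assms(4))
  qed
  have line: "int (gen_hamming_weight C (m - 1)) = int q ^ (m - 1) - 1"
  proof -
    have "m - (m - 1) = 1" using assms(3) by simp
    then have "int (gen_hamming_weight C (m - 1)) = int q ^ (m - 1) - int 1"
      using Q.card_value_line_le[OF _ a] Q.ex_line_meeting_level_set[OF a]
      by (intro weight) simp_all
    then show ?thesis by simp
  qed
  have full: "int (gen_hamming_weight C m) = int q ^ (m - 1)"
  proof -
    have empty: "card {x\<in>W. Q.F x = a} = 0" if "V.subspace W" "card W = 1" for W
    proof -
      obtain w where "W = {w}" using \<open>card W = 1\<close> by (rule card_1_singletonE)
      then have "W = {0}" using V.subspace_0[OF that(1)] by simp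
      then show ?thesis using a Q.f_zero by simp
    qed
    have "int (gen_hamming_weight C m) = int q ^ (m - 1) - int 0"
    proof (rule weight)
      show "\<exists>W. V.subspace W \<and> card W = CARD('k) ^ (m - m) \<and> card {x\<in>W. Q.F x = a} = 0"
        using empty[OF V.subspace_single_0] by (intro exI[of _ "{0}"]) simp
    qed (use empty in simp_all)
    then show ?thesis by simp
  qed
  show ?thesis
    using code.subspace_range_word code.dim_range_word large small line full unfolding C_eq by blast
qed

end
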